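(* Let $\mu,\nu\in P_2(\mathbb{R}^d)$. Then $$\mathcal{T}_2(\mathrm{P}^{cx}_{2,\mu\le},\nu)=\mathcal{D}_2(\mathrm{P}^{cx}_{2,\mu\le},\nu)=\mathcal{D}_2(\mu,\mathrm{P}^{cx}_{2,\le\nu})=\mathcal{T}_2(\mu,\mathrm{P}^{cx}_{2,\le\nu}).$$ Moreover: (i) if $\varphi^f\in\mathcal{A}_{cx}\cap C_{b,2}$ attains $\mathcal{D}_2(\mathrm{P}^{cx}_{2,\mu\le},\nu)$, then $Q_{\bar2}(\varphi^f)\in\mathcal{A}_{cx}\cap L^1(d\nu)$ and $\int Q_2(Q_{\bar2}(\varphi^f))\,d\mu-\int Q_{\bar2}(\varphi^f)\,d\nu=\mathcal{D}_2(\mu,\mathrm{P}^{cx}_{2,\le\nu})$; (ii) if $\varphi^b\in\mathcal{A}_{cx}\cap L^1(d\nu)$ attains $\mathcal{D}_2(\mu,\mathrm{P}^{cx}_{2,\le\nu})$, then $Q_2(\varphi^b)\in\mathcal{A}_{cx}\cap\mathrm{S}_{b,2}$ and $\int Q_2(\varphi^b)\,d\mu-\int Q_{\bar2}(Q_2(\varphi^b))\,d\nu=\mathcal{D}_2(\mathrm{P}^{cx}_{2,\mu\le},\nu)$.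
   Context: $\mu\le_{cx}\nu$: $\int\varphi\,d\mu\le\int\varphi\,d\nu$ for all real-valued convex $\varphi$ with both integrals existing in the extended sense. $\mathcal{A}_{cx}$: proper lsc convex functions $\mathbb{R}^d\to\mathbb{R}\cup\{+\infty\}$. $\mathrm{P}^{cx}_{2,\le\nu}=\{\eta\in P_2:\eta\le_{cx}\nu\}$, $\mathrm{P}^{cx}_{2,\mu\le}=\{\xi\in P_2:\mu\le_{cx}\xi\}$. $\mathcal{T}_2$ is the optimal transport cost for $|x-y|^2$, infimized over the cone where a cone appears. $Q_2(\varphi)(x)=\inf_y\{\varphi(y)+|x-y|^2\}$, $Q_{\bar2}(\varphi)(y)=\sup_x\{\varphi(x)-|x-y|^2\}$. $\mathrm{S}_{b,2}$ (resp. $C_{b,2}$): measurable (resp. continuous) $u$ with $\sup|u(x)|/(1+|x|^2)<\infty$. $\mathcal{D}_2(\mu,\mathrm{P}^{cx}_{2,\le\nu})=\sup_{\varphi\in\mathcal{A}_{cx}\cap L^1(d\nu)}\{\int Q_2(\varphi)d\mu-\int\varphi d\nu\}$ (which equals the same supremum over $\mathcal{A}_{cx}\cap\mathrm{S}_{b,2}$), and $\mathcal{D}_2(\mathrm{P}^{cx}_{2,\mu\le},\nu)=\sup_{\varphi\in\mathcal{A}_{cx}\cap\mathrm{S}_{b,2}}\{\int\varphi d\mu-\int Q_{\bar2}(\varphi)d\nu\}$. *)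

theory Defs
  imports "HOL-Probability.Probability"
begin

definition P2 :: "('a::euclidean_space) measure set" where
  "P2 = {\<mu>. prob_space \<mu> \<and> sets \<mu> = sets borel \<and>
             integrable \<mu> (\<lambda>x. norm x ^ 2)}"

definition eint :: "'a measure \<Rightarrow> ('a \<Rightarrow> ereal) \<Rightarrow> ereal" where
  "eint M f = enn2ereal (\<integral>\<^sup>+ x. e2ennreal (f x) \<partial>M)
              - enn2ereal (\<integral>\<^sup>+ x. e2ennreal (- f x) \<partial>M)"

definition eint_exists :: "'a measure \<Rightarrow> ('a \<Rightarrow> ereal) \<Rightarrow> bool" where
  "eint_exists M f \<longleftrightarrow> f \<in> borel_measurable M \<and>
     \<not> ((\<integral>\<^sup>+ x. e2ennreal (f x) \<partial>M) = \<infinity> \<and> (\<integral>\<^sup>+ x. e2ennreal (- f x) \<partial>M) = \<infinity>)"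

definition cx_le :: "'a::euclidean_space measure \<Rightarrow> 'a measure \<Rightarrow> bool" where
  "cx_le \<mu> \<nu> \<longleftrightarrow> (\<forall>\<phi>::'a \<Rightarrow> real. convex_on UNIV \<phi> \<longrightarrow>
      eint_exists \<mu> (\<lambda>x. ereal (\<phi> x)) \<longrightarrow> eint_exists \<nu> (\<lambda>x. ereal (\<phi> x)) \<longrightarrow>
      eint \<mu> (\<lambda>x. ereal (\<phi> x)) \<le> eint \<nu> (\<lambda>x. ereal (\<phi> x)))"

definition P2_cx_le :: "'a::euclidean_space measure \<Rightarrow> 'a measure set" where
  "P2_cx_le \<nu> = {\<eta> \<in> P2. cx_le \<eta> \<nu>}"

definition P2_cx_ge :: "'a::euclidean_space measure \<Rightarrow> 'a measure set" where
  "P2_cx_ge \<mu> = {\<xi> \<in> P2. cx_le \<mu> \<xi>}"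

definition Acx :: "('a::euclidean_space \<Rightarrow> ereal) \<Rightarrow> bool" where
  "Acx \<phi> \<longleftrightarrow> (\<forall>x. \<phi> x \<noteq> -\<infinity>) \<and> (\<exists>x. \<phi> x \<noteq> \<infinity>) \<and>
     (\<forall>x y t. 0 \<le> t \<and> t \<le> 1 \<longrightarrow>
        \<phi> ((1 - t) *\<^sub>R x + t *\<^sub>R y) \<le> ereal (1 - t) * \<phi> x + ereal t * \<phi> y) \<and>
     (\<forall>c. closed {x. \<phi> x \<le> c})"

definition L1 :: "'a::euclidean_space measure \<Rightarrow> ('a \<Rightarrow> ereal) \<Rightarrow> bool" where
  "L1 \<nu> \<phi> \<longleftrightarrow> \<phi> \<in> borel_measurable borel \<and> (AE x in \<nu>. \<bar>\<phi> x\<bar> \<noteq> \<infinity>) \<and>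
     integrable \<nu> (\<lambda>x. real_of_ereal (\<phi> x))"

definition Sb2 :: "('a::euclidean_space \<Rightarrow> ereal) \<Rightarrow> bool" where
  "Sb2 u \<longleftrightarrow> u \<in> borel_measurable borel \<and>
     (\<exists>C. \<forall>x. \<bar>u x\<bar> \<le> ereal (C * (1 + norm x ^ 2)))"

definition Cb2 :: "('a::euclidean_space \<Rightarrow> ereal) \<Rightarrow> bool" where
  "Cb2 u \<longleftrightarrow> continuous_on UNIV u \<and> (\<exists>C. \<forall>x. \<bar>u x\<bar> \<le> ereal (C * (1 + norm x ^ 2)))"

definition Q2 :: "('a::euclidean_space \<Rightarrow> ereal) \<Rightarrow> 'a \<Rightarrow> ereal" where
  "Q2 \<phi> x = (INF y. \<phi> y + ereal (norm (x - y) ^ 2))"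

definition Qbar2 :: "('a::euclidean_space \<Rightarrow> ereal) \<Rightarrow> 'a \<Rightarrow> ereal" where
  "Qbar2 \<phi> y = (SUP x. \<phi> x - ereal (norm (x - y) ^ 2))"

definition couplings :: "'a::euclidean_space measure \<Rightarrow> 'a measure \<Rightarrow> ('a \<times> 'a) measure set" where
  "couplings \<mu> \<nu> = {\<pi>. prob_space \<pi> \<and> sets \<pi> = sets (borel \<Otimes>\<^sub>M borel) \<and>
      distr \<pi> borel fst = \<mu> \<and> distr \<pi> borel snd = \<nu>}"

definition T2 :: "'a::euclidean_space measure \<Rightarrow> 'a measure \<Rightarrow> ereal" where
  "T2 \<mu> \<nu> = (INF \<pi> \<in> couplings \<mu> \<nu>. enn2ereal (\<integral>\<^sup>+ z. ennreal (norm (fst z - snd z) ^ 2) \<partial>\<pi>))"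

definition T2_left :: "'a::euclidean_space measure \<Rightarrow> 'a measure \<Rightarrow> ereal" where
  "T2_left \<mu> \<nu> = (INF \<xi> \<in> P2_cx_ge \<mu>. T2 \<xi> \<nu>)"

definition T2_right :: "'a::euclidean_space measure \<Rightarrow> 'a measure \<Rightarrow> ereal" where
  "T2_right \<mu> \<nu> = (INF \<eta> \<in> P2_cx_le \<nu>. T2 \<mu> \<eta>)"

definition D2_right :: "'a::euclidean_space measure \<Rightarrow> 'a measure \<Rightarrow> ereal" where
  "D2_right \<mu> \<nu> = (SUP \<phi> \<in> {\<phi>. Acx \<phi> \<and> L1 \<nu> \<phi>}. eint \<mu> (Q2 \<phi>) - eint \<nu> \<phi>)"

definition D2_left :: "'a::euclidean_space measure \<Rightarrow> 'a measure \<Rightarrow> ereal" where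
  "D2_left \<mu> \<nu> = (SUP \<phi> \<in> {\<phi>. Acx \<phi> \<and> Sb2 \<phi>}. eint \<mu> \<phi> - eint \<nu> (Qbar2 \<phi>))"

end

theory Submission
  imports Defs
begin

text \<open>Let \<open>b X\<close> be the conditional mean of \<open>Y\<close> given \<open>X\<close> under a coupling \<open>(X, Y)\<close> of \<open>\<mu>\<close>
  and \<open>\<nu>\<close>. By Jensen, the law of \<open>b X\<close> is below \<open>\<nu>\<close> and the law of \<open>X + Y - b X\<close> is above \<open>\<mu>\<close>
  in the convex order, and both have transport cost at most the mean of \<open>|X - b X|\<^sup>2\<close>. So it
  suffices to find couplings for which this barycentric cost is nearly the dual value; Strassen's
  theorem is not needed. Partition the target space into finitely many small cells. The
  barycentric cost is then minimized over weights in a simplex subject to finitely many mean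
  constraints. By coercivity the concave dual function of the multipliers attains its maximum, and
  the first-order condition there yields weights satisfying the constraints exactly. The value
  function in the source point is convex; multiplied by a factor below one it is a test function
  for the dual problem, the deficit of the factor absorbing the cell diameters.\<close>

section \<open>Convex functions\<close>

text \<open>The factor below one is forced. For \<open>y\<close> in the cell with mean
  \<open>m\<close>, the available upper bound on the value function is \<open>|x - m|^2\<close> plus
  a constant, and \<open>|x - m|^2 - |x - y|^2\<close> is affine in \<open>x\<close>, hence
  unbounded above unless \<open>y = m\<close>. With a factor \<open>a < 1\<close> the supremum of
  \<open>a * |x - m|^2 - |x - y|^2\<close> is \<open>a / (1 - a) * |y - m|^2\<close>. This fixes the
  order of choices: first \<open>a\<close>, then a partition so fine that its error is small against
  \<open>1 - a\<close>. The finite partition also decides the shape of the coupling. Weights over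
  cells of positive mass give a bounded density with respect to the product measure, so conditional
  means are plain integrals and no disintegration is involved. All comparisons pass through
  \<open>D2_left\<close>: integrating the transform inequality puts it below both transport values,
  and the couplings bound both transport values by it. \<open>D2_right\<close> is reached through
  the transforms.\<close>

lemma convex_on_imp_subgradient:
  fixes f :: "'a::euclidean_space \<Rightarrow> real"
  assumes f: "convex_on UNIV f"
  obtains g where "\<And>y. f x + g \<bullet> (y - x) \<le> f y"
proof -
  define S where "S = {z::'a \<times> real. f (fst z) < snd z}"
  have "convex S"
    unfolding S_def convex_alt
  proof (intro ballI allI impI)
    fix z z' :: "'a \<times> real" and u :: real
    assume z: "z \<in> {z. f (fst z) < snd z}" "z' \<in> {z. f (fst z) < snd z}" "0 \<le> u \<and> u \<le> 1"
    have "f ((1 - u) *\<^sub>R fst z + u *\<^sub>R fst z') \<le> (1 - u) * f (fst z) + u * f (fst z')"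
      using convex_onD[OF f, of u "fst z" "fst z'"] z by auto
    also have "\<dots> < (1 - u) * snd z + u * snd z'"
    proof (cases "u = 0")
      case False
      then show ?thesis using z by (intro add_le_less_mono mult_left_mono mult_strict_left_mono) auto
    qed (use z in auto)
    finally show "(1 - u) *\<^sub>R z + u *\<^sub>R z' \<in> {z. f (fst z) < snd z}"
      by simp
  qed
  moreover have "(x, f x + 1) \<in> S" by (simp add: S_def)
  then have "S \<noteq> {}" by blast
  moreover have "convex {(x, f x)}" "{(x, f x)} \<noteq> {}" "{(x, f x)} \<inter> S = {}"
    by (auto simp: S_def)
  ultimately obtain a b where ab: "a \<noteq> 0" "inner a (x, f x) \<le> b" "\<And>z. z \<in> S \<Longrightarrow> b \<le> inner a z"
    using separating_hyperplane_sets[of "{(x, f x)}" S] by (metis singletonI)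
  obtain c d where a: "a = (c, d)" by (cases a)
  have main: "c \<bullet> x + d * f x \<le> c \<bullet> y + d * t" if "f y < t" for y t
    using ab(2) ab(3)[of "(y, t)"] that by (auto simp: a S_def)
  have "0 \<le> d"
  proof (rule ccontr)
    assume "\<not> 0 \<le> d"
    then show False using main[of x "f x + 1"] by (simp add: algebra_simps)
  qed
  \<comment> \<open>A vertical hyperplane is excluded because \<open>f\<close> is finite on the
    whole space: the functional \<open>c\<close> would have to stay above
    \<open>c \<bullet> x\<close> in every direction, which the point \<open>x - c\<close> refutes
    unless \<open>c = 0\<close>.\<close>
  moreover have "d \<noteq> 0"
  proof
    assume d: "d = 0"
    have "c \<bullet> x \<le> c \<bullet> (x - c)"
      using main[of "x - c" "f (x - c) + 1"] d by simp
    then have "c = 0" using inner_gt_zero_iff[of c] by (simp add: inner_diff_right not_less[symmetric] del: inner_gt_zero_iff)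
    then show False using ab(1) a d by (simp add: zero_prod_def)
  qed
  ultimately have d: "0 < d" by simp
  have "f x + (- (1 / d) *\<^sub>R c) \<bullet> (y - x) \<le> f y" for y
  proof (rule field_le_epsilon)
    fix e :: real assume "0 < e"
    then have "c \<bullet> x + d * f x \<le> c \<bullet> y + d * (f y + e)" using main by simp
    moreover have "d * (f x + (- (1 / d) *\<^sub>R c) \<bullet> (y - x)) = d * f x - c \<bullet> (y - x)"
      using d by (simp add: right_diff_distrib)
    ultimately have "d * (f x + (- (1 / d) *\<^sub>R c) \<bullet> (y - x)) \<le> d * (f y + e)"
      by (simp add: inner_diff_right algebra_simps)
    then show "f x + (- (1 / d) *\<^sub>R c) \<bullet> (y - x) \<le> f y + e"
      using d by simp
  qed
  then show thesis using that by blast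
qed

lemma continuous_on_convex_UNIV:
  fixes f :: "'a::euclidean_space \<Rightarrow> real"
  shows "convex_on UNIV f \<Longrightarrow> continuous_on UNIV f"
  by (intro convex_on_continuous) auto

lemma borel_measurable_convex [measurable_dest]:
  fixes f :: "'a::euclidean_space \<Rightarrow> real"
  shows "convex_on UNIV f \<Longrightarrow> f \<in> borel_measurable borel"
  by (intro borel_measurable_continuous_onI continuous_on_convex_UNIV)

lemma Acx_ereal:
  fixes f :: "'a::euclidean_space \<Rightarrow> real"
  shows "Acx (\<lambda>x. ereal (f x)) \<longleftrightarrow> convex_on UNIV f"
proof
  assume "Acx (\<lambda>x. ereal (f x))"
  then show "convex_on UNIV f"
    unfolding Acx_def by (intro convex_onI) auto
next
  assume f: "convex_on UNIV f"
  have "closed {x. ereal (f x) \<le> c}" for c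
    by (intro closed_Collect_le continuous_intros continuous_on_convex_UNIV[OF f])
  then show "Acx (\<lambda>x. ereal (f x))"
    unfolding Acx_def using convex_onD[OF f] by auto
qed

lemma norm_convex_comb_square:
  fixes u v :: "'a::real_inner"
  shows "norm ((1 - t) *\<^sub>R u + t *\<^sub>R v) ^ 2 =
    (1 - t) * norm u ^ 2 + t * norm v ^ 2 - t * (1 - t) * norm (u - v) ^ 2"
  unfolding power2_norm_eq_inner
  by (simp add: inner_simps inner_commute algebra_simps power2_eq_square)

lemma norm_convex_comb_square_le:
  fixes u v :: "'a::real_inner"
  assumes "0 \<le> t" "t \<le> 1"
  shows "norm ((1 - t) *\<^sub>R u + t *\<^sub>R v) ^ 2 \<le> (1 - t) * norm u ^ 2 + t * norm v ^ 2"
  using assms by (simp add: norm_convex_comb_square)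

lemma norm_add_square_le:
  fixes u v :: "'a::real_normed_vector"
  shows "norm (u + v) ^ 2 \<le> 2 * norm u ^ 2 + 2 * norm v ^ 2"
proof -
  have "norm (u + v) ^ 2 \<le> (norm u + norm v) ^ 2"
    by (intro power_mono norm_triangle_ineq) auto
  also have "\<dots> \<le> 2 * norm u ^ 2 + 2 * norm v ^ 2"
    using sum_squares_bound[of "norm u" "norm v"] by (simp add: power2_sum)
  finally show ?thesis .
qed

lemma norm_diff_square_le:
  fixes u v :: "'a::real_normed_vector"
  shows "norm (u - v) ^ 2 \<le> 2 * norm u ^ 2 + 2 * norm v ^ 2"
  using norm_add_square_le[of u "- v"] by simp

text \<open>By lower semicontinuity the function stays above \<open>\<phi> x\<^sub>0 - 1\<close> near a point \<open>x\<^sub>0\<close> of its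
  domain, and convexity propagates this along rays.\<close>
lemma Acx_lower_bound:
  fixes \<phi> :: "'a::euclidean_space \<Rightarrow> ereal"
  assumes "Acx \<phi>"
  obtains a L x0 where "0 \<le> L" "\<phi> x0 \<noteq> \<infinity>" "\<phi> x0 \<noteq> -\<infinity>" "\<And>y. ereal (a - L * norm (y - x0)) \<le> \<phi> y"
proof -
  obtain x0 where x0: "\<phi> x0 \<noteq> \<infinity>" using assms by (auto simp: Acx_def)
  have mi: "\<phi> x \<noteq> -\<infinity>" for x using assms by (auto simp: Acx_def)
  obtain c where c: "\<phi> x0 = ereal c" using x0 mi by (cases "\<phi> x0") auto
  have "closed {x. \<phi> x \<le> ereal (c - 1)}" using assms by (auto simp: Acx_def)
  then have "open (- {x. \<phi> x \<le> ereal (c - 1)})" by auto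
  moreover have "x0 \<in> - {x. \<phi> x \<le> ereal (c - 1)}" by (simp add: c)
  ultimately obtain r where r: "0 < r" "ball x0 r \<subseteq> - {x. \<phi> x \<le> ereal (c - 1)}"
    by (meson openE)
  have near: "ereal (c - 1) < \<phi> y" if "dist x0 y < r" for y
    using r(2) that by (auto simp: subset_iff not_le)
  have "ereal (c - 1 - 2 / r * norm (y - x0)) \<le> \<phi> y" for y
  proof (cases "dist x0 y < r")
    case True
    have "ereal (c - 1 - 2 / r * norm (y - x0)) \<le> ereal (c - 1)" using r by simp
    also have "\<dots> \<le> \<phi> y" using near[OF True] by simp
    finally show ?thesis .
  next
    case False
    define s where "s = norm (y - x0)"
    have s: "r \<le> s" using False by (simp add: s_def dist_norm norm_minus_commute)
    \<comment> \<open>This \<open>t\<close> puts \<open>z\<close> at distance \<open>r / 2\<close>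
      from \<open>x0\<close>, inside the ball where the bound holds; the slope \<open>2 / r\<close>
      is the reciprocal of that distance.\<close>
    define t where "t = (r / 2) / s"
    have t: "0 < t" "t \<le> 1" using r(1) s by (auto simp: t_def)
    define z where "z = (1 - t) *\<^sub>R x0 + t *\<^sub>R y"
    have "z - x0 = t *\<^sub>R (y - x0)" by (simp add: z_def algebra_simps)
    then have "norm (z - x0) = t * s" using t by (simp add: s_def)
    then have "dist x0 z < r" using r(1) s by (simp add: dist_norm norm_minus_commute t_def)
    then have 1: "ereal (c - 1) < \<phi> z" by (rule near)
    have 2: "\<phi> z \<le> ereal (1 - t) * \<phi> x0 + ereal t * \<phi> y"
      using assms t unfolding Acx_def z_def by auto
    show ?thesis
    proof (cases "\<phi> y")
      case (real v)
      have "c - 1 < (1 - t) * c + t * v" using less_le_trans[OF 1 2] by (simp add: c real)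
      then have "c - 1 / t < v" using t by (simp add: field_simps)
      moreover have "1 / t = 2 / r * s" using r(1) s by (simp add: t_def)
      ultimately show ?thesis by (simp add: real s_def)
    qed (use mi in auto)
  qed
  then show thesis using that[of "2 / r" x0 "c - 1"] x0 mi r(1) by auto
qed

section \<open>Integrals of extended-real functions\<close>

lemma eint_mono_AE:
  assumes "AE x in M. f x \<le> g x"
  shows "eint M f \<le> eint M g"
  unfolding eint_def using assms
  by (intro ereal_minus_mono) (auto simp flip: less_eq_ennreal.rep_eq intro!: nn_integral_mono_AE e2ennreal_mono)

lemma eint_mono: "(\<And>x. f x \<le> g x) \<Longrightarrow> eint M f \<le> eint M g"
  by (intro eint_mono_AE) auto

lemma eint_cong_AE:
  assumes "AE x in M. f x = g x"
  shows "eint M f = eint M g"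
  using assms by (intro antisym eint_mono_AE) auto

lemma eint_integrable:
  assumes "integrable M f"
  shows "eint M (\<lambda>x. ereal (f x)) = ereal (integral\<^sup>L M f)"
proof -
  have "(\<integral>\<^sup>+x. ennreal (f x) \<partial>M) < \<infinity>" "(\<integral>\<^sup>+x. ennreal (- f x) \<partial>M) < \<infinity>"
    using assms by (auto simp: real_integrable_def top.not_eq_extremum)
  moreover have "integral\<^sup>L M f = enn2real (\<integral>\<^sup>+x. ennreal (f x) \<partial>M) - enn2real (\<integral>\<^sup>+x. ennreal (- f x) \<partial>M)"
    using assms by (rule real_lebesgue_integral_def)
  ultimately show ?thesis
    unfolding eint_def by (cases "\<integral>\<^sup>+x. ennreal (f x) \<partial>M"; cases "\<integral>\<^sup>+x. ennreal (- f x) \<partial>M") auto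
qed

text \<open>Adding an integrable majorant of the negative part reduces \<^const>\<open>eint\<close> to a single
  nonnegative integral, to which monotone convergence applies.\<close>
lemma eint_shift:
  assumes B: "integrable M B" "\<And>x. 0 \<le> B x" and f: "f \<in> borel_measurable M"
    and fB: "\<And>x. ereal (- B x) \<le> f x"
  shows "eint M f = enn2ereal (\<integral>\<^sup>+x. e2ennreal (f x + ereal (B x)) \<partial>M) - ereal (integral\<^sup>L M B)"
proof -
  have [measurable]: "B \<in> borel_measurable M" using B by auto
  note f[measurable]
  \<comment> \<open>The identity between positive and negative parts is written with sums only, as
    subtraction in \<open>ennreal\<close> truncates; it rests on \<open>f + B\<close> being
    nonnegative.\<close>
  have pt: "e2ennreal (f x) + ennreal (B x) = e2ennreal (f x + ereal (B x)) + e2ennreal (- f x)" for x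
    using fB[of x] B(2)[of x]
    by (cases "f x") (auto simp: ennreal_plus[symmetric] ennreal_neg max_def simp del: ennreal_plus, 
      cases "0 \<le> real_of_ereal (f x)", auto simp: ennreal_neg ennreal_plus[symmetric] simp del: ennreal_plus)
  have Bi: "(\<integral>\<^sup>+x. ennreal (B x) \<partial>M) = ennreal (integral\<^sup>L M B)"
    using B by (intro nn_integral_eq_integral) auto
  have IB: "0 \<le> integral\<^sup>L M B" using B by (intro integral_nonneg_AE) auto
  have "(\<integral>\<^sup>+x. e2ennreal (- f x) \<partial>M) \<le> (\<integral>\<^sup>+x. ennreal (B x) \<partial>M)"
  proof (intro nn_integral_mono)
    fix x
    have "- f x \<le> ereal (B x)" using fB[of x] ereal_uminus_le_reorder by fastforce
    then show "e2ennreal (- f x) \<le> ennreal (B x)" using e2ennreal_mono by fastforce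
  qed
  then have fin: "(\<integral>\<^sup>+x. e2ennreal (- f x) \<partial>M) < \<infinity>" unfolding Bi by (auto simp: le_less_trans top.not_eq_extremum)
  have "(\<integral>\<^sup>+x. e2ennreal (f x) \<partial>M) + (\<integral>\<^sup>+x. ennreal (B x) \<partial>M)
      = (\<integral>\<^sup>+x. e2ennreal (f x + ereal (B x)) \<partial>M) + (\<integral>\<^sup>+x. e2ennreal (- f x) \<partial>M)"
    by (subst (1 2) nn_integral_add[symmetric]) (auto simp: pt)
  then show ?thesis
    unfolding eint_def Bi using fin IB
    apply (cases "\<integral>\<^sup>+x. e2ennreal (f x) \<partial>M"; cases "\<integral>\<^sup>+x. e2ennreal (f x + ereal (B x)) \<partial>M"; cases "\<integral>\<^sup>+x. e2ennreal (- f x) \<partial>M")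
    by (auto simp: ennreal_plus[symmetric] simp del: ennreal_plus)
qed

text \<open>Meant for transforms such as \<open>Qbar2\<close>, which have an integrable minorant but
  may be infinite: the negative part is always integrable, so a value other than
  \<open>\<infinity>\<close> is enough to recover an ordinary integrable function.\<close>

lemma eint_lower_bounded:
  assumes "integrable M B" "\<And>x. 0 \<le> B x" and "f \<in> borel_measurable M"
    and "\<And>x. ereal (- B x) \<le> f x"
  shows "eint M f \<noteq> -\<infinity>"
    and "eint_exists M f"
    and "eint M f \<noteq> \<infinity> \<Longrightarrow> AE x in M. \<bar>f x\<bar> \<noteq> \<infinity>"
    and "eint M f \<noteq> \<infinity> \<Longrightarrow> integrable M (\<lambda>x. real_of_ereal (f x))"
proof -
  have [measurable]: "B \<in> borel_measurable M" using assms by auto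
  note assms(3)[measurable]
  show "eint M f \<noteq> -\<infinity>" 
    unfolding eint_shift[OF assms] by (cases "(\<integral>\<^sup>+x. e2ennreal (f x + ereal (B x)) \<partial>M)") auto
  have "(\<integral>\<^sup>+x. e2ennreal (- f x) \<partial>M) \<le> (\<integral>\<^sup>+x. ennreal (B x) \<partial>M)"
  proof (intro nn_integral_mono)
    fix x
    have "- f x \<le> ereal (B x)" using assms(4)[of x] ereal_uminus_le_reorder by fastforce
    then show "e2ennreal (- f x) \<le> ennreal (B x)" using e2ennreal_mono by fastforce
  qed
  also have "\<dots> = ennreal (integral\<^sup>L M B)"
    using assms by (intro nn_integral_eq_integral) auto
  finally have neg: "(\<integral>\<^sup>+x. e2ennreal (- f x) \<partial>M) \<noteq> \<infinity>" by (auto simp: top_unique)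
  then show "eint_exists M f" unfolding eint_exists_def by auto
  assume "eint M f \<noteq> \<infinity>"
  then have pos: "(\<integral>\<^sup>+x. e2ennreal (f x) \<partial>M) \<noteq> \<infinity>" unfolding eint_def by auto
  have "AE x in M. e2ennreal (f x) \<noteq> \<infinity>"
    by (intro nn_integral_noteq_infinite) (use pos in auto)
  then show AE: "AE x in M. \<bar>f x\<bar> \<noteq> \<infinity>"
  proof eventually_elim
    case (elim x)
    then show ?case using assms(4)[of x] by (cases "f x") auto
  qed
  have "(\<integral>\<^sup>+x. ennreal (real_of_ereal (f x)) \<partial>M) = (\<integral>\<^sup>+x. e2ennreal (f x) \<partial>M)"
    "(\<integral>\<^sup>+x. ennreal (- real_of_ereal (f x)) \<partial>M) = (\<integral>\<^sup>+x. e2ennreal (- f x) \<partial>M)"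
    using AE by (auto intro!: nn_integral_cong_AE elim!: eventually_mono simp: ereal_real' simp flip: e2ennreal_ereal)
  then show "integrable M (\<lambda>x. real_of_ereal (f x))"
    using pos neg by (auto simp: real_integrable_def)
qed

lemma eint_distr:
  assumes [measurable]: "T \<in> measurable M N" "f \<in> borel_measurable N"
  shows "eint (distr M N T) f = eint M (\<lambda>x. f (T x))"
  unfolding eint_def by (simp add: nn_integral_distr)

section \<open>Measures with finite second moment\<close>

lemma P2D:
  assumes "\<mu> \<in> P2"
  shows "prob_space \<mu>" "sets \<mu> = sets borel" "space \<mu> = UNIV" "integrable \<mu> (\<lambda>x. norm x ^ 2)"
  using assms sets_eq_imp_space_eq[of \<mu> borel] by (auto simp: P2_def)

lemma P2_integrable_quadratic:
  fixes f :: "'a::euclidean_space \<Rightarrow> 'b::{banach, second_countable_topology}"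
  assumes "\<mu> \<in> P2" "f \<in> borel_measurable borel" "\<And>x. norm (f x) \<le> C * (1 + norm x ^ 2)"
  shows "integrable \<mu> f"
proof -
  interpret prob_space \<mu> using P2D(1)[OF assms(1)] .
  note [measurable_cong] = P2D(2)[OF assms(1)]
  have "integrable \<mu> (\<lambda>x. C * (1 + norm x ^ 2))"
    using P2D(4)[OF assms(1)] by simp
  moreover have "f \<in> borel_measurable \<mu>" using assms(2) by simp
  ultimately show ?thesis
    by (rule Bochner_Integration.integrable_bound) (auto intro!: order_trans[OF assms(3)])
qed

lemma norm_le_one_plus_square: "(t::real) \<le> 1 + t ^ 2"
proof -
  have "0 \<le> (t - 1 / 2) ^ 2" by simp
  then show ?thesis by (simp add: power2_diff power_divide algebra_simps)
qed

lemma convex_on_lower_bound: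
  fixes f :: "'a::euclidean_space \<Rightarrow> real"
  assumes "convex_on UNIV f"
  obtains C where "0 \<le> C" "\<And>x. - (C * (1 + norm x ^ 2)) \<le> f x"
proof -
  obtain g where g: "\<And>y. f 0 + g \<bullet> (y - 0) \<le> f y"
    using convex_on_imp_subgradient[OF assms, of 0] by blast
  have "- ((\<bar>f 0\<bar> + norm g) * (1 + norm x ^ 2)) \<le> f x" for x
  proof -
    have "0 \<le> \<bar>f 0\<bar> * norm x ^ 2" by simp
    moreover have "- (g \<bullet> x) \<le> norm g * norm x" using Cauchy_Schwarz_ineq2[of g x] by simp
    moreover have "norm g * norm x \<le> norm g * (1 + norm x ^ 2)"
      by (intro mult_left_mono norm_le_one_plus_square) auto
    ultimately show ?thesis using g[of x] unfolding distrib_left distrib_right mult_1_right diff_zero by linarith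
  qed
  then show thesis using that[of "\<bar>f 0\<bar> + norm g"] by auto
qed

lemma P2_integrable_weight:
  "\<mu> \<in> P2 \<Longrightarrow> integrable \<mu> (\<lambda>x. C * (1 + norm x ^ 2))"
  by (rule P2_integrable_quadratic[where C = "\<bar>C\<bar>"]) (auto simp: abs_mult)

lemma P2_eint_lower_bounded:
  fixes \<phi> :: "'a::euclidean_space \<Rightarrow> ereal"
  assumes "\<mu> \<in> P2" "\<phi> \<in> borel_measurable borel" "0 \<le> C" "\<And>x. ereal (- (C * (1 + norm x ^ 2))) \<le> \<phi> x"
  shows "eint \<mu> \<phi> \<noteq> -\<infinity>"
    and "eint_exists \<mu> \<phi>"
    and "eint \<mu> \<phi> \<noteq> \<infinity> \<Longrightarrow> AE x in \<mu>. \<bar>\<phi> x\<bar> \<noteq> \<infinity>"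
    and "eint \<mu> \<phi> \<noteq> \<infinity> \<Longrightarrow> integrable \<mu> (\<lambda>x. real_of_ereal (\<phi> x))"
proof -
  note [measurable_cong] = P2D(2)[OF assms(1)]
  have "\<phi> \<in> borel_measurable \<mu>" using assms(2) by simp
  note * = eint_lower_bounded[of \<mu> "\<lambda>x. C * (1 + norm x ^ 2)" \<phi>, OF P2_integrable_weight[OF assms(1)] _ this assms(4)]
  show "eint \<mu> \<phi> \<noteq> -\<infinity>" "eint_exists \<mu> \<phi>" using *(1,2) assms(3) by auto
  assume "eint \<mu> \<phi> \<noteq> \<infinity>"
  then show "AE x in \<mu>. \<bar>\<phi> x\<bar> \<noteq> \<infinity>" "integrable \<mu> (\<lambda>x. real_of_ereal (\<phi> x))" 
    using *(3,4) assms(3) by auto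
qed

text \<open>An affine minorant grows at most quadratically, so the negative part is integrable. On
  \<open>P2\<close> the existence clauses of \<open>cx_le\<close> are thus automatic.\<close>

lemma eint_exists_convex:
  fixes f :: "'a::euclidean_space \<Rightarrow> real"
  assumes "\<mu> \<in> P2" "convex_on UNIV f"
  shows "eint_exists \<mu> (\<lambda>x. ereal (f x))"
proof -
  obtain C where C: "0 \<le> C" "\<And>x. - (C * (1 + norm x ^ 2)) \<le> f x"
    using convex_on_lower_bound[OF assms(2)] by blast
  show ?thesis
    by (rule P2_eint_lower_bounded(2)[OF assms(1) _ C(1)])
       (use C borel_measurable_convex[OF assms(2)] in auto)
qed

lemma cx_leD:
  assumes "cx_le \<mu> \<nu>" "\<mu> \<in> P2" "\<nu> \<in> P2" "convex_on UNIV f"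
  shows "eint \<mu> (\<lambda>x. ereal (f x)) \<le> eint \<nu> (\<lambda>x. ereal (f x))"
  using assms eint_exists_convex unfolding cx_le_def by blast

lemma closed_sublevel_imp_borel_measurable:
  fixes \<phi> :: "'a::euclidean_space \<Rightarrow> ereal"
  assumes "\<And>c. closed {x. \<phi> x \<le> c}"
  shows "\<phi> \<in> borel_measurable borel"
  unfolding borel_measurable_iff_Iic_ereal
proof
  fix a
  have "\<phi> -` {..a} \<inter> space borel = {x. \<phi> x \<le> a}" by auto
  then show "\<phi> -` {..a} \<inter> space borel \<in> sets borel" using assms[of a] by simp
qed

section \<open>The transforms \<^const>\<open>Q2\<close> and \<^const>\<open>Qbar2\<close>\<close>

lemma le_Qbar2_plus: "\<phi> x \<le> Qbar2 \<phi> y + ereal (norm (x - y) ^ 2)"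
proof -
  have "\<phi> x - ereal (norm (x - y) ^ 2) \<le> Qbar2 \<phi> y"
    unfolding Qbar2_def by (rule SUP_upper) simp
  then show ?thesis
    by (simp add: ereal_minus_le_iff)
qed

lemma Qbar2_ge: "\<phi> x \<le> Qbar2 \<phi> x"
  using le_Qbar2_plus[of \<phi> x x] by (simp flip: zero_ereal_def)

lemma Q2_le: "Q2 \<phi> x \<le> \<phi> y + ereal (norm (x - y) ^ 2)"
  unfolding Q2_def by (rule INF_lower) simp

text \<open>Both \<open>\<phi> \<le> Q2 \<psi>\<close> and \<open>Qbar2 \<phi> \<le> \<psi>\<close>
  say that \<open>\<phi> x \<le> \<psi> y + |x - y|^2\<close> for all \<open>x\<close> and
  \<open>y\<close>. The transforms are therefore adjoint; this inequality and the next are the unit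
  and counit.\<close>

lemma Q2_Qbar2_ge: "\<phi> x \<le> Q2 (Qbar2 \<phi>) x"
  unfolding Q2_def using le_Qbar2_plus by (intro INF_greatest)

lemma Qbar2_Q2_le: "Qbar2 (Q2 \<phi>) y \<le> \<phi> y"
  unfolding Qbar2_def by (intro SUP_least) (simp add: ereal_minus_le_iff Q2_le)

lemma closed_Qbar2_sublevel:
  assumes "continuous_on UNIV f"
  shows "closed {y. Qbar2 (\<lambda>x. ereal (f x)) y \<le> c}"
proof -
  have "{y. Qbar2 (\<lambda>x. ereal (f x)) y \<le> c} = (\<Inter>x. {y. ereal (f x - norm (x - y) ^ 2) \<le> c})"
    unfolding Qbar2_def by (auto simp: SUP_le_iff)
  also have "closed \<dots>"
    by (intro closed_INT ballI closed_Collect_le continuous_intros)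
  finally show ?thesis .
qed

lemma borel_measurable_Qbar2:
  assumes "continuous_on UNIV f"
  shows "Qbar2 (\<lambda>x. ereal (f x)) \<in> borel_measurable borel"
  by (intro closed_sublevel_imp_borel_measurable closed_Qbar2_sublevel assms)

text \<open>With \<open>z = x - y\<close>, the transform is a supremum of translates \<open>f (y + z) - |z|\<^sup>2\<close>,
  hence convex in \<open>y\<close>.\<close>
lemma Acx_Qbar2:
  fixes f :: "'a::euclidean_space \<Rightarrow> real"
  assumes f: "convex_on UNIV f" and fin: "Qbar2 (\<lambda>x. ereal (f x)) y0 \<noteq> \<infinity>"
  shows "Acx (Qbar2 (\<lambda>x. ereal (f x)))"
proof -
  let ?Q = "Qbar2 (\<lambda>x. ereal (f x))"
  have mi: "?Q y \<noteq> -\<infinity>" for y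
    using Qbar2_ge[of "\<lambda>x. ereal (f x)" y] by auto
  have "?Q ((1 - t) *\<^sub>R x + t *\<^sub>R y) \<le> ereal (1 - t) * ?Q x + ereal t * ?Q y" if t: "0 \<le> t" "t \<le> 1" for x y t
  proof -
    define w where "w = (1 - t) *\<^sub>R x + t *\<^sub>R y"
    have "?Q w \<le> ereal (1 - t) * ?Q x + ereal t * ?Q y"
      unfolding Qbar2_def[of _ w]
    proof (intro SUP_least)
      fix u :: 'a
      define z where "z = u - w"
      have Q: "ereal (f (v + z) - norm z ^ 2) \<le> ?Q v" for v
        using SUP_upper[of "v + z" UNIV "\<lambda>x. ereal (f x) - ereal (norm (x - v) ^ 2)"]
        by (simp add: Qbar2_def)
      have "(1 - t) *\<^sub>R (x + z) + t *\<^sub>R (y + z) = u"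
        by (simp add: z_def w_def algebra_simps)
      then have "f u \<le> (1 - t) * f (x + z) + t * f (y + z)"
        using convex_onD[OF f, of t "x + z" "y + z"] t by auto
      then have "f u - norm z ^ 2 \<le> (1 - t) * (f (x + z) - norm z ^ 2) + t * (f (y + z) - norm z ^ 2)"
        by (simp add: algebra_simps)
      then have "ereal (f u) - ereal (norm (u - w) ^ 2) \<le>
          ereal (1 - t) * ereal (f (x + z) - norm z ^ 2) + ereal t * ereal (f (y + z) - norm z ^ 2)"
        by (simp add: z_def)
      also have "\<dots> \<le> ereal (1 - t) * ?Q x + ereal t * ?Q y"
        using t by (intro add_mono ereal_mult_left_mono Q) auto
      finally show "ereal (f u) - ereal (norm (u - w) ^ 2) \<le> ereal (1 - t) * ?Q x + ereal t * ?Q y" .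
    qed
    then show ?thesis unfolding w_def .
  qed
  then show ?thesis
    unfolding Acx_def using mi fin closed_Qbar2_sublevel[OF continuous_on_convex_UNIV[OF f]] by blast
qed

lemma Sb2_real:
  assumes "Acx \<phi>" "Sb2 \<phi>"
  obtains f C where "\<phi> = (\<lambda>x. ereal (f x))" "convex_on UNIV f" "0 \<le> C" "\<And>x. \<bar>f x\<bar> \<le> C * (1 + norm x ^ 2)"
proof -
  obtain C where C: "\<And>x. \<bar>\<phi> x\<bar> \<le> ereal (C * (1 + norm x ^ 2))"
    using assms(2) by (auto simp: Sb2_def)
  define f where "f = (\<lambda>x. real_of_ereal (\<phi> x))"
  have f: "\<phi> x = ereal (f x)" for x using C[of x] unfolding f_def by (cases "\<phi> x") auto
  have bd: "\<bar>f x\<bar> \<le> C * (1 + norm x ^ 2)" for x using C[of x] by (simp add: f)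
  have "0 \<le> C" using bd[of 0] by simp
  moreover have "\<phi> = (\<lambda>x. ereal (f x))" using f by blast
  then have "convex_on UNIV f" using assms(1) Acx_ereal[of f] by simp
  ultimately show thesis using that[of f C] f bd by auto
qed

lemma Sb2_ereal:
  fixes f :: "'a::euclidean_space \<Rightarrow> real"
  assumes "f \<in> borel_measurable borel" "\<And>x. \<bar>f x\<bar> \<le> C * (1 + norm x ^ 2)"
  shows "Sb2 (\<lambda>x. ereal (f x))"
  using assms by (auto simp: Sb2_def)

text \<open>The transform is the partial infimum over \<open>y\<close> of a jointly convex function,
  hence convex. It is always real: the quadratic cost beats the linear minorant of
  \<open>\<phi>\<close> from below, and one point \<open>x0\<close> of the domain gives a quadratic
  bound from above.\<close>

lemma Acx_Q2:
  fixes \<phi> :: "'a::euclidean_space \<Rightarrow> ereal"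
  assumes \<phi>: "Acx \<phi>"
  shows "Acx (Q2 \<phi>)" "Sb2 (Q2 \<phi>)"
proof -
  obtain a L x0 where L: "0 \<le> L" "\<phi> x0 \<noteq> \<infinity>" "\<phi> x0 \<noteq> -\<infinity>" and lb: "\<And>y. ereal (a - L * norm (y - x0)) \<le> \<phi> y"
    using Acx_lower_bound[OF \<phi>] by metis
  obtain c where c: "\<phi> x0 = ereal c" using L by (cases "\<phi> x0") auto
  have lower: "ereal (a - L * norm (x - x0) - L ^ 2 / 4) \<le> Q2 \<phi> x" for x
    unfolding Q2_def
  proof (intro INF_greatest)
    fix y
    have "norm (y - x0) \<le> norm (x - y) + norm (x - x0)"
      using norm_triangle_ineq[of "y - x" "x - x0"] by (simp add: norm_minus_commute)
    then have "L * norm (y - x0) \<le> L * norm (x - y) + L * norm (x - x0)"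
      using L(1) by (metis distrib_left mult_left_mono)
    \<comment> \<open>Completing the square: \<open>L^2 / 4\<close> is the largest value of
      \<open>L * t - t^2\<close>.\<close>
    moreover have "0 \<le> (norm (x - y) - L / 2) ^ 2" by simp
    then have "L * norm (x - y) \<le> norm (x - y) ^ 2 + L ^ 2 / 4"
      by (simp add: power2_diff power_divide algebra_simps)
    ultimately have "a - L * norm (x - x0) - L ^ 2 / 4 \<le> (a - L * norm (y - x0)) + norm (x - y) ^ 2"
      by linarith
    then have "ereal (a - L * norm (x - x0) - L ^ 2 / 4) \<le> ereal (a - L * norm (y - x0)) + ereal (norm (x - y) ^ 2)"
      by simp
    also have "\<dots> \<le> \<phi> y + ereal (norm (x - y) ^ 2)" by (intro add_mono lb) auto
    finally show "ereal (a - L * norm (x - x0) - L ^ 2 / 4) \<le> \<phi> y + ereal (norm (x - y) ^ 2)" .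
  qed
  have upper: "Q2 \<phi> x \<le> ereal (c + norm (x - x0) ^ 2)" for x
    using Q2_le[of \<phi> x x0] by (simp add: c)
  define q where "q = (\<lambda>x. real_of_ereal (Q2 \<phi> x))"
  have q: "Q2 \<phi> = (\<lambda>x. ereal (q x))"
  proof
    fix x show "Q2 \<phi> x = ereal (q x)"
      using lower[of x] upper[of x] unfolding q_def by (cases "Q2 \<phi> x") auto
  qed
  have conv: "convex_on UNIV q"
  proof (rule convex_onI)
    fix t :: real and x y :: 'a assume t: "0 < t" "t < 1"
    show "q ((1 - t) *\<^sub>R x + t *\<^sub>R y) \<le> (1 - t) * q x + t * q y"
    proof (rule field_le_epsilon)
      fix e :: real assume e: "0 < e"
      \<comment> \<open>Points that are optimal up to \<open>e\<close> stand in for minimizers,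
        whose existence is not claimed.\<close>
      have near: "\<exists>u v. \<phi> u = ereal v \<and> v + norm (x - u) ^ 2 \<le> q x + e" for x
      proof -
        have "(INF y. \<phi> y + ereal (norm (x - y) ^ 2)) < ereal (q x + e)"
          using q e by (simp add: Q2_def fun_eq_iff)
        then obtain u where u: "\<phi> u + ereal (norm (x - u) ^ 2) < ereal (q x + e)"
          by (auto simp: INF_less_iff)
        then show ?thesis using lb[of u] by (cases "\<phi> u") (auto intro!: exI[of _ u] less_imp_le)
      qed
      obtain u v where u: "\<phi> u = ereal v" "v + norm (x - u) ^ 2 \<le> q x + e" using near by blast
      obtain u' v' where u': "\<phi> u' = ereal v'" "v' + norm (y - u') ^ 2 \<le> q y + e" using near by blast
      define w where "w = (1 - t) *\<^sub>R u + t *\<^sub>R u'"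
      have "\<phi> w \<le> ereal (1 - t) * \<phi> u + ereal t * \<phi> u'"
        using \<phi> t unfolding w_def Acx_def by auto
      then have w: "\<phi> w \<le> ereal ((1 - t) * v + t * v')" by (simp add: u u')
      have "(1 - t) *\<^sub>R x + t *\<^sub>R y - w = (1 - t) *\<^sub>R (x - u) + t *\<^sub>R (y - u')"
        by (simp add: w_def algebra_simps)
      then have n: "norm ((1 - t) *\<^sub>R x + t *\<^sub>R y - w) ^ 2 \<le> (1 - t) * norm (x - u) ^ 2 + t * norm (y - u') ^ 2"
        using t by (simp add: norm_convex_comb_square_le)
      have "ereal (q ((1 - t) *\<^sub>R x + t *\<^sub>R y)) \<le> \<phi> w + ereal (norm ((1 - t) *\<^sub>R x + t *\<^sub>R y - w) ^ 2)"
        using Q2_le[of \<phi> _ w] by (simp add: q)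
      also have "\<dots> \<le> ereal ((1 - t) * v + t * v') + ereal ((1 - t) * norm (x - u) ^ 2 + t * norm (y - u') ^ 2)"
        using n by (intro add_mono w) auto
      finally have "q ((1 - t) *\<^sub>R x + t *\<^sub>R y) \<le> (1 - t) * (v + norm (x - u) ^ 2) + t * (v' + norm (y - u') ^ 2)"
        by (simp add: algebra_simps)
      also have "\<dots> \<le> (1 - t) * (q x + e) + t * (q y + e)"
        using t by (intro add_mono mult_left_mono u u') auto
      finally show "q ((1 - t) *\<^sub>R x + t *\<^sub>R y) \<le> (1 - t) * q x + t * q y + e"
        by (simp add: algebra_simps)
    qed
  qed auto
  then show "Acx (Q2 \<phi>)" by (simp add: q Acx_ereal)
  define C where "C = \<bar>a\<bar> + L + L * norm x0 + L ^ 2 / 4 + \<bar>c\<bar> + 2 + 2 * norm x0 ^ 2"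
  have "\<bar>q x\<bar> \<le> C * (1 + norm x ^ 2)" for x
  proof -
    have 1: "a - L * norm (x - x0) - L ^ 2 / 4 \<le> q x" using lower[of x] by (simp add: q)
    have 2: "q x \<le> c + norm (x - x0) ^ 2" using upper[of x] by (simp add: q)
    have 3: "norm (x - x0) ^ 2 \<le> 2 * norm x ^ 2 + 2 * norm x0 ^ 2" by (rule norm_diff_square_le)
    have "norm (x - x0) \<le> (1 + norm x ^ 2) + norm x0"
      using norm_triangle_ineq4[of x x0] norm_le_one_plus_square[of "norm x"] by linarith
    then have 4: "L * norm (x - x0) \<le> L * ((1 + norm x ^ 2) + norm x0)"
      using L(1) by (intro mult_left_mono)
    have 5: "k \<le> k * (1 + norm x ^ 2)" if "0 \<le> k" for k :: real
      using that by (simp add: algebra_simps)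
    have 6: "0 \<le> L * norm x0" "0 \<le> L * norm x ^ 2" using L(1) by auto
    have "\<bar>q x\<bar> \<le> \<bar>a\<bar> + L * (1 + norm x ^ 2) + L * norm x0 + L ^ 2 / 4 + \<bar>c\<bar> + 2 * (1 + norm x ^ 2) + 2 * norm x0 ^ 2"
      using 1 2 3 4 6 L(1) zero_le_power2[of "norm x"] zero_le_power2[of "norm x0"] zero_le_power2[of L]
      unfolding distrib_left mult_1_right by linarith
    also have "\<dots> \<le> C * (1 + norm x ^ 2)"
      unfolding C_def distrib_right
      using 5[of "\<bar>a\<bar>"] 5[of "L * norm x0"] 5[of "L ^ 2 / 4"] 5[of "\<bar>c\<bar>"] 5[of "2 * norm x0 ^ 2"] L(1)
      by (intro add_mono) auto
    finally show ?thesis .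
  qed
  then show "Sb2 (Q2 \<phi>)" unfolding q by (intro Sb2_ereal borel_measurable_convex conv)
qed

section \<open>Weak duality\<close>

lemma P2_integrable_convex:
  fixes f :: "'a::euclidean_space \<Rightarrow> real"
  assumes "\<mu> \<in> P2" "convex_on UNIV f" "\<And>x. \<bar>f x\<bar> \<le> C * (1 + norm x ^ 2)"
  shows "integrable \<mu> f"
  using assms by (intro P2_integrable_quadratic[of \<mu> f C] borel_measurable_convex) auto

lemma couplingsD:
  fixes \<pi> :: "('a::euclidean_space \<times> 'a) measure"
  assumes "\<pi> \<in> couplings \<alpha> \<beta>"
  shows "prob_space \<pi>" "sets \<pi> = sets (borel \<Otimes>\<^sub>M borel)" "distr \<pi> borel fst = \<alpha>" "distr \<pi> borel snd = \<beta>"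
    "fst \<in> \<pi> \<rightarrow>\<^sub>M borel" "snd \<in> \<pi> \<rightarrow>\<^sub>M borel"
  using assms measurable_cong_sets[of \<pi> "borel \<Otimes>\<^sub>M borel" borel borel] by (auto simp: couplings_def)

lemma Qbar2_lower_bound:
  fixes f :: "'a::euclidean_space \<Rightarrow> real"
  assumes "\<And>x. \<bar>f x\<bar> \<le> C * (1 + norm x ^ 2)"
  shows "ereal (- (C * (1 + norm x ^ 2))) \<le> Qbar2 (\<lambda>x. ereal (f x)) x"
  using assms[of x] by (intro order_trans[OF _ Qbar2_ge]) (auto simp: abs_le_iff)

lemma eint_Qbar2_neq_minus_infinity:
  fixes f :: "'a::euclidean_space \<Rightarrow> real"
  assumes "\<nu> \<in> P2" "convex_on UNIV f" "0 \<le> C" "\<And>x. \<bar>f x\<bar> \<le> C * (1 + norm x ^ 2)"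
  shows "eint \<nu> (Qbar2 (\<lambda>x. ereal (f x))) \<noteq> -\<infinity>"
  by (intro P2_eint_lower_bounded(1)[OF assms(1) _ assms(3)] Qbar2_lower_bound borel_measurable_Qbar2
      continuous_on_convex_UNIV assms)

text \<open>Weak Kantorovich duality: the inequality \<open>le_Qbar2_plus\<close> is integrated
  along the coupling. An infinite term on the right leaves nothing to prove, because the integral of
  the transform is never \<open>-\<infinity>\<close>.\<close>

lemma integral_le_eint_Qbar2_plus_cost:
  fixes f :: "'a::euclidean_space \<Rightarrow> real"
  assumes P2: "\<alpha> \<in> P2" "\<beta> \<in> P2" and \<pi>: "\<pi> \<in> couplings \<alpha> \<beta>"
    and f: "convex_on UNIV f" "0 \<le> C" "\<And>x. \<bar>f x\<bar> \<le> C * (1 + norm x ^ 2)"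
  shows "ereal (integral\<^sup>L \<alpha> f) \<le> eint \<beta> (Qbar2 (\<lambda>x. ereal (f x)))
    + enn2ereal (\<integral>\<^sup>+ z. ennreal (norm (fst z - snd z) ^ 2) \<partial>\<pi>)"
    (is "_ \<le> eint \<beta> ?Q + enn2ereal ?cost")
proof -
  note [measurable] = couplingsD(5,6)[OF \<pi>]
  note lb = Qbar2_lower_bound[of f, OF f(3)]
  have Qm[measurable]: "?Q \<in> borel_measurable borel"
    by (intro borel_measurable_Qbar2 continuous_on_convex_UNIV f)
  note [measurable] = borel_measurable_convex[OF f(1)]
  note * = P2_eint_lower_bounded[OF P2(2) Qm f(2) lb]
  show ?thesis
  proof (cases "eint \<beta> ?Q = \<infinity> \<or> ?cost = \<infinity>")
    case True
    then show ?thesis using *(1) by auto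
  next
    case False
    define g where "g = (\<lambda>y. real_of_ereal (?Q y))"
    have [measurable]: "g \<in> borel_measurable borel" unfolding g_def by measurable
    have AE: "AE y in \<beta>. ?Q y = ereal (g y)" and int: "integrable \<beta> g"
      using *(3,4) False by (auto simp: g_def ereal_real' elim!: eventually_mono)
    have "AE z in \<pi>. ?Q (snd z) = ereal (g (snd z))"
      using AE unfolding couplingsD(4)[OF \<pi>, symmetric] by (rule AE_distrD[OF couplingsD(6)[OF \<pi>]])
    then have AE2: "AE z in \<pi>. f (fst z) \<le> g (snd z) + norm (fst z - snd z) ^ 2"
    proof eventually_elim
      case (elim z)
      then show ?case using le_Qbar2_plus[of "\<lambda>x. ereal (f x)" "fst z" "snd z"] by simp
    qed
    have c: "integrable \<pi> (\<lambda>z. norm (fst z - snd z) ^ 2)"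
      using False by (intro integrableI_bounded) (auto simp: top.not_eq_extremum)
    have g: "integrable \<pi> (\<lambda>z. g (snd z))" "integral\<^sup>L \<beta> g = (\<integral>z. g (snd z) \<partial>\<pi>)"
      using int integrable_distr_eq[of snd \<pi> borel g] integral_distr[of snd \<pi> borel g] by (auto simp: couplingsD(4)[OF \<pi>])
    have fi: "integrable \<pi> (\<lambda>z. f (fst z))" "integral\<^sup>L \<alpha> f = (\<integral>z. f (fst z) \<partial>\<pi>)"
      using P2_integrable_convex[OF P2(1) f(1,3)] integrable_distr_eq[of fst \<pi> borel f] integral_distr[of fst \<pi> borel f]
      by (auto simp: couplingsD(3)[OF \<pi>])
    have "eint \<beta> ?Q = eint \<beta> (\<lambda>y. ereal (g y))" using AE by (rule eint_cong_AE)
    also have "\<dots> = ereal (integral\<^sup>L \<beta> g)" using int by (rule eint_integrable)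
    finally have Q: "eint \<beta> ?Q = ereal (integral\<^sup>L \<beta> g)" .
    have cost: "?cost = ennreal (\<integral>z. norm (fst z - snd z) ^ 2 \<partial>\<pi>)"
      by (intro nn_integral_eq_integral c) auto
    have "integral\<^sup>L \<alpha> f \<le> integral\<^sup>L \<beta> g + (\<integral>z. norm (fst z - snd z) ^ 2 \<partial>\<pi>)"
      unfolding fi g Bochner_Integration.integral_add[OF g(1) c, symmetric]
      by (intro integral_mono_AE fi(1) Bochner_Integration.integrable_add g c AE2)
    then show ?thesis
      unfolding Q cost by simp
  qed
qed

text \<open>The transform \<^term>\<open>Qbar2\<close> may take the value infinity, whereas the convex order
  only tests real functions; restricting the supremum to \<open>|z| \<le> k\<close> gives real convex functions
  increasing to it.\<close>
lemma cx_le_eint_Qbar2: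
  fixes f :: "'a::euclidean_space \<Rightarrow> real"
  assumes P2: "\<eta> \<in> P2" "\<nu> \<in> P2" and cx: "cx_le \<eta> \<nu>"
    and f: "convex_on UNIV f" "0 \<le> C" "\<And>x. \<bar>f x\<bar> \<le> C * (1 + norm x ^ 2)"
  shows "eint \<eta> (Qbar2 (\<lambda>x. ereal (f x))) \<le> eint \<nu> (Qbar2 (\<lambda>x. ereal (f x)))"
    (is "eint \<eta> ?Q \<le> eint \<nu> ?Q")
proof -
  define g where "g = (\<lambda>(k::nat) y. SUP z\<in>cball 0 (real k). f (y + z) - norm z ^ 2)"
  have ne: "cball (0::'a) (real k) \<noteq> {}" for k by simp
  have bdd: "bdd_above ((\<lambda>z. f (y + z) - norm z ^ 2) ` cball 0 (real k))" for y k
  proof (rule bdd_aboveI2)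
    fix z :: 'a assume z: "z \<in> cball 0 (real k)"
    have "f (y + z) - norm z ^ 2 \<le> C * (1 + norm (y + z) ^ 2)" using f(3)[of "y + z"] zero_le_power2[of "norm z"] unfolding abs_le_iff by linarith
    also have "\<dots> \<le> C * (1 + (norm y + real k) ^ 2)"
      using z f(2) norm_triangle_ineq[of y z] by (intro mult_left_mono add_left_mono power_mono) auto
    finally show "f (y + z) - norm z ^ 2 \<le> C * (1 + (norm y + real k) ^ 2)" .
  qed
  have g_upper: "f (y + z) - norm z ^ 2 \<le> g k y" if "norm z \<le> real k" for y z k
    unfolding g_def using that by (intro cSUP_upper bdd) auto
  have g_least: "g k y \<le> B" if "\<And>z. norm z \<le> real k \<Longrightarrow> f (y + z) - norm z ^ 2 \<le> B" for y k B
    unfolding g_def using that by (intro cSUP_least ne) auto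
  have g_conv: "convex_on UNIV (g k)" for k
  proof (rule convex_onI)
    fix t :: real and x y :: 'a assume t: "0 < t" "t < 1"
    show "g k ((1 - t) *\<^sub>R x + t *\<^sub>R y) \<le> (1 - t) * g k x + t * g k y"
    proof (rule g_least)
      fix z :: 'a assume z: "norm z \<le> real k"
      have "(1 - t) *\<^sub>R x + t *\<^sub>R y + z = (1 - t) *\<^sub>R (x + z) + t *\<^sub>R (y + z)"
        by (simp add: algebra_simps)
      then have "f ((1 - t) *\<^sub>R x + t *\<^sub>R y + z) \<le> (1 - t) * f (x + z) + t * f (y + z)"
        using convex_onD[OF f(1), of t "x + z" "y + z"] t by simp
      then have "f ((1 - t) *\<^sub>R x + t *\<^sub>R y + z) - norm z ^ 2 \<le>
          (1 - t) * (f (x + z) - norm z ^ 2) + t * (f (y + z) - norm z ^ 2)"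
        by (simp add: algebra_simps)
      also have "\<dots> \<le> (1 - t) * g k x + t * g k y"
        using t by (intro add_mono mult_left_mono g_upper z) auto
      finally show "f ((1 - t) *\<^sub>R x + t *\<^sub>R y + z) - norm z ^ 2 \<le> (1 - t) * g k x + t * g k y" .
    qed
  qed auto
  have g_le_Q: "ereal (g k y) \<le> ?Q y" for k y
  proof -
    have "ereal (f (y + z) - norm z ^ 2) \<le> ?Q y" for z
      using le_Qbar2_plus[of "\<lambda>x. ereal (f x)" "y + z" y]
      by (simp add: ereal_minus_le_iff flip: ereal_minus(1)) 
    then show ?thesis
      using g_least[of k y "real_of_ereal (?Q y)"] by (cases "?Q y") auto
  qed
  have f_le_g: "f y \<le> g k y" for k y using g_upper[of 0 k y] by simp
  define B where "B = (\<lambda>x::'a. C * (1 + norm x ^ 2))"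
  have B: "integrable \<eta> B" "\<And>x. 0 \<le> B x"
    unfolding B_def using P2_integrable_weight[OF P2(1)] f(2) by auto
  have fB: "- B x \<le> f x" for x using f(3)[of x] by (auto simp: B_def abs_le_iff)
  have gB: "- B x \<le> g k x" for k x using fB[of x] f_le_g[of x k] by simp
  have QB: "ereal (- B x) \<le> ?Q x" for x
    using gB[of x 0] by (intro order_trans[OF _ g_le_Q[of 0]]) auto
  note [measurable_cong] = P2D(2)[OF P2(1)]
  have [measurable]: "?Q \<in> borel_measurable borel"
    by (intro borel_measurable_Qbar2 continuous_on_convex_UNIV f)
  have [measurable]: "g k \<in> borel_measurable borel" for k by (intro borel_measurable_convex g_conv)
  have [measurable]: "B \<in> borel_measurable borel" unfolding B_def by measurable
  show ?thesis
  proof (cases "eint \<nu> ?Q = \<infinity>")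
    case False
    have step: "enn2ereal (\<integral>\<^sup>+x. ennreal (g k x + B x) \<partial>\<eta>) \<le> eint \<nu> ?Q + ereal (integral\<^sup>L \<eta> B)" for k
    proof -
      have "eint \<eta> (\<lambda>x. ereal (g k x)) \<le> eint \<nu> (\<lambda>x. ereal (g k x))"
        by (intro cx_leD[OF cx P2 g_conv])
      also have "\<dots> \<le> eint \<nu> ?Q" by (intro eint_mono g_le_Q)
      finally have "enn2ereal (\<integral>\<^sup>+x. ennreal (g k x + B x) \<partial>\<eta>) - ereal (integral\<^sup>L \<eta> B) \<le> eint \<nu> ?Q"
        by (subst (asm) eint_shift[OF B]) (auto simp: gB)
      then show ?thesis by (simp add: ereal_minus_le_iff add.commute)
    qed
    have "0 \<le> eint \<nu> ?Q + ereal (integral\<^sup>L \<eta> B)"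
      by (rule order_trans[OF enn2ereal_nonneg step])
    then have step': "(\<integral>\<^sup>+x. ennreal (g k x + B x) \<partial>\<eta>) \<le> e2ennreal (eint \<nu> ?Q + ereal (integral\<^sup>L \<eta> B))" for k
      using e2ennreal_mono[OF step] by simp
    have inc: "incseq (\<lambda>k x. ennreal (g k x + B x))"
    proof (intro incseq_SucI le_funI ennreal_leI add_right_mono g_least)
      fix k x and z :: 'a assume "norm z \<le> real k"
      then show "f (x + z) - norm z ^ 2 \<le> g (Suc k) x" by (intro g_upper) simp
    qed
    have "(\<integral>\<^sup>+x. e2ennreal (?Q x + ereal (B x)) \<partial>\<eta>) \<le> (\<integral>\<^sup>+x. (SUP k. ennreal (g k x + B x)) \<partial>\<eta>)"
    proof (intro nn_integral_mono)
      fix x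
      let ?S = "SUP k. ennreal (g k x + B x)"
      have "?Q x \<le> enn2ereal ?S - ereal (B x)"
        unfolding Qbar2_def
      proof (intro SUP_least)
        fix u
        obtain k :: nat where k: "norm (u - x) \<le> real k" using real_arch_simple by blast
        have "f u - norm (u - x) ^ 2 \<le> g k x" using g_upper[OF k, of x] by simp
        then have "ereal (f u - norm (u - x) ^ 2 + B x) \<le> enn2ereal (ennreal (g k x + B x))"
          using gB[of x k] by simp
        also have "\<dots> \<le> enn2ereal ?S"
          by (simp flip: less_eq_ennreal.rep_eq) (rule SUP_upper, simp)
        finally show "ereal (f u) - ereal (norm (u - x) ^ 2) \<le> enn2ereal ?S - ereal (B x)"
          by (simp add: ereal_le_minus_iff)
      qed
      then have "?Q x + ereal (B x) \<le> enn2ereal ?S" by (simp add: ereal_le_minus_iff)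
      then show "e2ennreal (?Q x + ereal (B x)) \<le> ?S" using e2ennreal_mono by fastforce
    qed
    also have "\<dots> = (SUP k. \<integral>\<^sup>+x. ennreal (g k x + B x) \<partial>\<eta>)"
      by (intro nn_integral_monotone_convergence_SUP inc) simp
    also have "\<dots> \<le> e2ennreal (eint \<nu> ?Q + ereal (integral\<^sup>L \<eta> B))"
      by (intro SUP_least step')
    finally have "enn2ereal (\<integral>\<^sup>+x. e2ennreal (?Q x + ereal (B x)) \<partial>\<eta>) \<le> eint \<nu> ?Q + ereal (integral\<^sup>L \<eta> B)"
      using \<open>0 \<le> eint \<nu> ?Q + _\<close> by (simp add: less_eq_ennreal.rep_eq enn2ereal_e2ennreal)
    then show ?thesis
      by (subst eint_shift[OF B]) (auto simp: QB ereal_minus_le_iff add.commute)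
  qed simp
qed

text \<open>Here the convex order acts on the test function itself: its integral grows from
  \<open>\<mu>\<close> to \<open>\<xi>\<close>, and the transform inequality is then integrated
  along a coupling of \<open>\<xi>\<close> and \<open>\<nu>\<close>.\<close>

lemma D2_left_le_T2_left:
  fixes \<mu> \<nu> :: "'a::euclidean_space measure"
  assumes "\<mu> \<in> P2" "\<nu> \<in> P2"
  shows "D2_left \<mu> \<nu> \<le> T2_left \<mu> \<nu>"
  unfolding D2_left_def T2_left_def T2_def
proof (intro SUP_least INF_greatest)
  fix \<phi> \<xi> \<pi>
  assume \<phi>: "\<phi> \<in> {\<phi>::'a \<Rightarrow> ereal. Acx \<phi> \<and> Sb2 \<phi>}" and \<xi>: "\<xi> \<in> P2_cx_ge \<mu>" and \<pi>: "\<pi> \<in> couplings \<xi> \<nu>"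
  obtain f C where f: "\<phi> = (\<lambda>x. ereal (f x))" "convex_on UNIV f" "0 \<le> C" "\<And>x. \<bar>f x\<bar> \<le> C * (1 + norm x ^ 2)"
    using Sb2_real \<phi> by blast
  have xi: "\<xi> \<in> P2" "cx_le \<mu> \<xi>" using \<xi> by (auto simp: P2_cx_ge_def)
  have "eint \<mu> \<phi> \<le> eint \<xi> \<phi>" unfolding f by (intro cx_leD xi assms f)
  also have "\<dots> = ereal (integral\<^sup>L \<xi> f)"
    unfolding f(1) by (intro eint_integrable P2_integrable_convex[OF xi(1) f(2,4)])
  also have "\<dots> \<le> eint \<nu> (Qbar2 \<phi>) + enn2ereal (\<integral>\<^sup>+ z. ennreal (norm (fst z - snd z) ^ 2) \<partial>\<pi>)"
    unfolding f(1) by (rule integral_le_eint_Qbar2_plus_cost[OF xi(1) assms(2) \<pi> f(2-4)])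
  finally show "eint \<mu> \<phi> - eint \<nu> (Qbar2 \<phi>) \<le> enn2ereal (\<integral>\<^sup>+ z. ennreal (norm (fst z - snd z) ^ 2) \<partial>\<pi>)"
    using eint_Qbar2_neq_minus_infinity[OF assms(2) f(2-4)]
    by (simp add: ereal_minus_le_iff eint_integrable[OF P2_integrable_convex[OF assms(1) f(2,4)]] f(1) add.commute)
qed

text \<open>Here the coupling comes first and the convex order acts on the transform, whose integral
  grows from \<open>\<eta>\<close> to \<open>\<nu>\<close>.\<close>

lemma D2_left_le_T2_right:
  fixes \<mu> \<nu> :: "'a::euclidean_space measure"
  assumes "\<mu> \<in> P2" "\<nu> \<in> P2"
  shows "D2_left \<mu> \<nu> \<le> T2_right \<mu> \<nu>"
  unfolding D2_left_def T2_right_def T2_def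
proof (intro SUP_least INF_greatest)
  fix \<phi> \<eta> \<pi>
  assume \<phi>: "\<phi> \<in> {\<phi>::'a \<Rightarrow> ereal. Acx \<phi> \<and> Sb2 \<phi>}" and \<eta>: "\<eta> \<in> P2_cx_le \<nu>" and \<pi>: "\<pi> \<in> couplings \<mu> \<eta>"
  obtain f C where f: "\<phi> = (\<lambda>x. ereal (f x))" "convex_on UNIV f" "0 \<le> C" "\<And>x. \<bar>f x\<bar> \<le> C * (1 + norm x ^ 2)"
    using Sb2_real \<phi> by blast
  have eta: "\<eta> \<in> P2" "cx_le \<eta> \<nu>" using \<eta> by (auto simp: P2_cx_le_def)
  have "eint \<mu> \<phi> = ereal (integral\<^sup>L \<mu> f)"
    unfolding f(1) by (intro eint_integrable P2_integrable_convex[OF assms(1) f(2,4)])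
  also have "\<dots> \<le> eint \<eta> (Qbar2 \<phi>) + enn2ereal (\<integral>\<^sup>+ z. ennreal (norm (fst z - snd z) ^ 2) \<partial>\<pi>)"
    unfolding f(1) by (rule integral_le_eint_Qbar2_plus_cost[OF assms(1) eta(1) \<pi> f(2-4)])
  also have "\<dots> \<le> eint \<nu> (Qbar2 \<phi>) + enn2ereal (\<integral>\<^sup>+ z. ennreal (norm (fst z - snd z) ^ 2) \<partial>\<pi>)"
    unfolding f(1) by (intro add_mono cx_le_eint_Qbar2[OF eta(1) assms(2) eta(2) f(2-4)] order_refl)
  finally show "eint \<mu> \<phi> - eint \<nu> (Qbar2 \<phi>) \<le> enn2ereal (\<integral>\<^sup>+ z. ennreal (norm (fst z - snd z) ^ 2) \<partial>\<pi>)"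
    using eint_Qbar2_neq_minus_infinity[OF assms(2) f(2-4)]
    by (simp add: ereal_minus_le_iff eint_integrable[OF P2_integrable_convex[OF assms(1) f(2,4)]] f(1) add.commute)
qed

section \<open>Equality of the two dual problems\<close>

lemma D2_left_upper:
  "Acx \<phi> \<Longrightarrow> Sb2 \<phi> \<Longrightarrow> eint \<mu> \<phi> - eint \<nu> (Qbar2 \<phi>) \<le> D2_left \<mu> \<nu>"
  unfolding D2_left_def by (rule SUP_upper) simp

lemma D2_right_upper:
  "Acx \<phi> \<Longrightarrow> L1 \<nu> \<phi> \<Longrightarrow> eint \<mu> (Q2 \<phi>) - eint \<nu> \<phi> \<le> D2_right \<mu> \<nu>"
  unfolding D2_right_def by (rule SUP_upper) simp

text \<open>One step of the usual improvement of a dual pair: the function paired with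
  \<open>Qbar2 \<phi>\<close> is replaced by the largest one admissible with it.\<close>

lemma Qbar2_dominates_dual_value:
  "eint \<mu> \<phi> - eint \<nu> (Qbar2 \<phi>) \<le> eint \<mu> (Q2 (Qbar2 \<phi>)) - eint \<nu> (Qbar2 \<phi>)"
  by (intro ereal_minus_mono eint_mono Q2_Qbar2_ge order_refl)

lemma Q2_dominates_dual_value:
  "eint \<mu> (Q2 \<phi>) - eint \<nu> \<phi> \<le> eint \<mu> (Q2 \<phi>) - eint \<nu> (Qbar2 (Q2 \<phi>))"
  by (intro ereal_minus_mono eint_mono Qbar2_Q2_le order_refl)

text \<open>The integral of \<open>\<phi>\<close> against \<open>\<mu>\<close> is real, so the last
  hypothesis amounts to the integral of \<open>Qbar2 \<phi>\<close> not being
  \<open>\<infinity>\<close>. Then \<open>Qbar2 \<phi>\<close> is finite almost everywhere, hence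
  somewhere, and that one point supplies properness.\<close>

lemma Qbar2_admissible:
  fixes \<phi> :: "'a::euclidean_space \<Rightarrow> ereal"
  assumes P2: "\<mu> \<in> P2" "\<nu> \<in> P2" and \<phi>: "Acx \<phi>" "Sb2 \<phi>"
    and fin: "eint \<mu> \<phi> - eint \<nu> (Qbar2 \<phi>) \<noteq> -\<infinity>"
  shows "Acx (Qbar2 \<phi>)" "L1 \<nu> (Qbar2 \<phi>)"
proof -
  obtain f C where f: "\<phi> = (\<lambda>x. ereal (f x))" "convex_on UNIV f" "0 \<le> C" "\<And>x. \<bar>f x\<bar> \<le> C * (1 + norm x ^ 2)"
    using Sb2_real \<phi> by blast
  have fin': "eint \<nu> (Qbar2 \<phi>) \<noteq> \<infinity>"
    using fin by (auto simp: f(1) eint_integrable[OF P2_integrable_convex[OF P2(1) f(2,4)]])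
  have m: "Qbar2 \<phi> \<in> borel_measurable borel"
    unfolding f(1) by (intro borel_measurable_Qbar2 continuous_on_convex_UNIV f)
  have lb: "ereal (- (C * (1 + norm x ^ 2))) \<le> Qbar2 \<phi> x" for x
    unfolding f(1) by (rule Qbar2_lower_bound[OF f(4)])
  note * = P2_eint_lower_bounded[OF P2(2) m f(3) lb]
  show "L1 \<nu> (Qbar2 \<phi>)" unfolding L1_def using m *(3,4)[OF fin'] by auto
  interpret prob_space \<nu> using P2D(1)[OF P2(2)] .
  have "\<exists>y. \<bar>Qbar2 \<phi> y\<bar> \<noteq> \<infinity>" using *(3)[OF fin']
    by (rule contrapos_pp) (simp add: AE_False)
  then show "Acx (Qbar2 \<phi>)" unfolding f(1) using Acx_Qbar2[OF f(2)] by fastforce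
qed

lemma D2_left_eq_D2_right:
  fixes \<mu> \<nu> :: "'a::euclidean_space measure"
  assumes "\<mu> \<in> P2" "\<nu> \<in> P2"
  shows "D2_left \<mu> \<nu> = D2_right \<mu> \<nu>"
proof (rule antisym)
  show "D2_left \<mu> \<nu> \<le> D2_right \<mu> \<nu>"
    unfolding D2_left_def
  proof (intro SUP_least)
    fix \<phi> assume \<phi>: "\<phi> \<in> {\<phi>::'a \<Rightarrow> ereal. Acx \<phi> \<and> Sb2 \<phi>}"
    show "eint \<mu> \<phi> - eint \<nu> (Qbar2 \<phi>) \<le> D2_right \<mu> \<nu>"
    proof (cases "eint \<mu> \<phi> - eint \<nu> (Qbar2 \<phi>) = -\<infinity>")
      case False
      then show ?thesis
        using \<phi> Qbar2_admissible[OF assms] by (intro order_trans[OF Qbar2_dominates_dual_value D2_right_upper]) auto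
    qed simp
  qed
  show "D2_right \<mu> \<nu> \<le> D2_left \<mu> \<nu>"
    unfolding D2_right_def
    by (intro SUP_least order_trans[OF Q2_dominates_dual_value D2_left_upper]) (auto intro: Acx_Q2)
qed

text \<open>The zero function is its own transform. The bound keeps the dual value away from
  \<open>-\<infinity>\<close>, so that an optimal \<open>\<phi>\<close> meets the finiteness
  condition of \<open>Qbar2_admissible\<close>.\<close>

lemma D2_left_nonneg:
  fixes \<mu> \<nu> :: "'a::euclidean_space measure"
  shows "0 \<le> D2_left \<mu> \<nu>"
proof -
  have "Qbar2 (\<lambda>x::'a. ereal 0) = (\<lambda>y. ereal 0)"
    using Qbar2_ge[of "\<lambda>x::'a. ereal 0"] 
    by (intro ext antisym) (auto simp: Qbar2_def intro!: SUP_least)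
  then have "eint \<mu> (\<lambda>x. ereal 0) - eint \<nu> (Qbar2 (\<lambda>x. ereal 0)) = 0"
    by (simp add: eint_def zero_ereal_def[symmetric])
  moreover have "Acx (\<lambda>x::'a. ereal 0)" "Sb2 (\<lambda>x::'a. ereal 0)"
    unfolding Acx_ereal by (auto intro!: Sb2_ereal[of _ 0] convex_onI)
  ultimately show ?thesis using D2_left_upper[of "\<lambda>x::'a. ereal 0" \<mu> \<nu>] by simp
qed

section \<open>The barycentric transport problem with finitely many targets\<close>

lemma compact_PiE_UNIV:
  fixes K :: "'i \<Rightarrow> 'b::topological_space set"
  assumes "\<And>i. compact (K i)"
  shows "compact (PiE UNIV K)"
  using compactin_PiE[of "\<lambda>_. euclidean" UNIV K] assms
  by (simp add: euclidean_product_topology)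

text \<open>Targets \<open>y i\<close> carry the prescribed masses \<open>p i\<close>. The term with factor \<open>\<epsilon>\<close> makes the
  minimizing weights unique and Lipschitz in the source point, so that they are measurable and the
  dual function is differentiable in the multipliers \<open>\<phi>\<close>.\<close>
locale barycentric_problem =
  fixes \<mu> :: "'a::euclidean_space measure" and I :: "'i set" and y :: "'i \<Rightarrow> 'a"
    and p :: "'i \<Rightarrow> real" and \<epsilon> :: real
  assumes P2: "\<mu> \<in> P2" and finite_I: "finite I" and p_pos: "\<And>i. i \<in> I \<Longrightarrow> 0 < p i"
    and sum_p: "sum p I = 1" and eps: "0 < \<epsilon>"
begin

text \<open>Weights live on the whole index type and vanish off \<open>I\<close>, so that the
  simplex is compact in the product topology even when the type is infinite.\<close>

definition weights :: "('i \<Rightarrow> real) set" where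
  "weights = {w. (\<forall>i. 0 \<le> w i \<and> w i \<le> 1) \<and> (\<forall>i. i \<notin> I \<longrightarrow> w i = 0) \<and> sum w I = 1}"

definition bary :: "('i \<Rightarrow> real) \<Rightarrow> 'a" where
  "bary w = (\<Sum>i\<in>I. w i *\<^sub>R y i)"

text \<open>Pointwise Lagrangian of the regularized problem: minimize the mean of
  \<open>|x - bary (w x)|^2\<close> under the constraints that \<open>w x i\<close> has mean
  \<open>p i\<close>. Its minimum over the simplex is \<open>q\<close>, and \<open>g\<close> is the
  Lagrange dual function.\<close>

definition F :: "('i \<Rightarrow> real) \<Rightarrow> 'a \<Rightarrow> ('i \<Rightarrow> real) \<Rightarrow> real" where
  "F \<phi> x w = norm (x - bary w) ^ 2 + \<epsilon> * (\<Sum>i\<in>I. w i ^ 2) + (\<Sum>i\<in>I. \<phi> i * w i)"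

definition W :: "('i \<Rightarrow> real) \<Rightarrow> 'a \<Rightarrow> 'i \<Rightarrow> real" where
  "W \<phi> x = (SOME w. w \<in> weights \<and> (\<forall>v\<in>weights. F \<phi> x w \<le> F \<phi> x v))"

definition q :: "('i \<Rightarrow> real) \<Rightarrow> 'a \<Rightarrow> real" where
  "q \<phi> x = F \<phi> x (W \<phi> x)"

definition g :: "('i \<Rightarrow> real) \<Rightarrow> real" where
  "g \<phi> = integral\<^sup>L \<mu> (q \<phi>) - (\<Sum>i\<in>I. \<phi> i * p i)"

definition R :: real where
  "R = (\<Sum>i\<in>I. norm (y i))"

definition vertex :: "'i \<Rightarrow> 'i \<Rightarrow> real" where
  "vertex i = (\<lambda>j. if j = i then 1 else 0)"

section \<open>Minimizing weights for fixed multipliers\<close>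

lemma weightsD:
  assumes "w \<in> weights"
  shows "0 \<le> w i" "w i \<le> 1" "i \<notin> I \<Longrightarrow> w i = 0" "sum w I = 1"
  using assms by (auto simp: weights_def)

lemma I_nonempty: "I \<noteq> {}"
  using sum_p by auto

lemma p_le_1: "i \<in> I \<Longrightarrow> p i \<le> 1"
  using sum_p member_le_sum[of i I p] p_pos finite_I by (auto intro: less_imp_le)

lemma vertex_weights: "i \<in> I \<Longrightarrow> vertex i \<in> weights"
  using finite_I by (auto simp: weights_def vertex_def)

lemma bary_vertex: "i \<in> I \<Longrightarrow> bary (vertex i) = y i"
  unfolding bary_def vertex_def using finite_I
  by (simp add: if_distrib[where f = "\<lambda>c. c *\<^sub>R _"] sum.delta cong: if_cong)

lemma F_vertex: 
  assumes "i \<in> I" 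
  shows "F \<phi> x (vertex i) = norm (x - y i) ^ 2 + \<epsilon> + \<phi> i"
proof -
  have "(\<Sum>j\<in>I. vertex i j ^ 2) = (\<Sum>j\<in>I. if j = i then 1 else 0)"
    "(\<Sum>j\<in>I. \<phi> j * vertex i j) = (\<Sum>j\<in>I. if j = i then \<phi> j else 0)"
    unfolding vertex_def by (auto intro!: sum.cong)
  then show ?thesis unfolding F_def using assms finite_I by (simp add: bary_vertex)
qed

lemma compact_weights: "compact weights"
proof -
  have "weights = PiE UNIV (\<lambda>i. if i \<in> I then {0..1} else {0}) \<inter> {w. sum w I = 1}"
    by (auto simp: weights_def PiE_iff split: if_splits) (metis order_refl zero_le_one)+
  moreover have "closed {w :: 'i \<Rightarrow> real. sum w I = 1}"
    by (intro closed_Collect_eq continuous_intros continuous_on_product_coordinates)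
  ultimately show ?thesis
    by (auto intro!: compact_Int_closed compact_PiE_UNIV)
qed

lemma continuous_on_F: "continuous_on S (F \<phi> x)"
proof -
  have c: "continuous_on S (\<lambda>w. w i)" for S and i :: 'i
    by (rule continuous_on_subset[OF continuous_on_product_coordinates]) auto
  show ?thesis unfolding F_def bary_def by (intro continuous_intros c)
qed

lemma W: "W \<phi> x \<in> weights" "\<And>v. v \<in> weights \<Longrightarrow> q \<phi> x \<le> F \<phi> x v"
proof -
  have "\<exists>w\<in>weights. \<forall>v\<in>weights. F \<phi> x w \<le> F \<phi> x v"
    using vertex_weights I_nonempty by (intro continuous_attains_inf compact_weights continuous_on_F) auto
  then have "\<exists>w. w \<in> weights \<and> (\<forall>v\<in>weights. F \<phi> x w \<le> F \<phi> x v)" by blast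
  from someI_ex[OF this] show "W \<phi> x \<in> weights" "\<And>v. v \<in> weights \<Longrightarrow> q \<phi> x \<le> F \<phi> x v"
    unfolding q_def W_def by auto
qed

lemma weights_convex:
  assumes "w \<in> weights" "w' \<in> weights" "0 \<le> t" "t \<le> 1"
  shows "(\<lambda>i. (1 - t) * w i + t * w' i) \<in> weights"
  using assms unfolding weights_def
  by (auto simp: sum.distrib sum_distrib_left[symmetric] intro!: convex_bound_le)

lemma bary_convex_comb:
  "bary (\<lambda>i. (1 - t) * w i + t * w' i) = (1 - t) *\<^sub>R bary w + t *\<^sub>R bary w'"
  unfolding bary_def by (simp add: scaleR_add_left sum.distrib scaleR_sum_right)

text \<open>All terms are quadratic or linear, so the convexity defect is exact. With
  \<open>x = x'\<close> it gives strong convexity in the weights; with \<open>x\<close> varying it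
  gives convexity of \<open>q\<close>.\<close>

lemma F_convex_comb:
  "F \<phi> ((1 - t) *\<^sub>R x + t *\<^sub>R x') (\<lambda>i. (1 - t) * w i + t * w' i) =
    (1 - t) * F \<phi> x w + t * F \<phi> x' w'
    - t * (1 - t) * (norm ((x - bary w) - (x' - bary w')) ^ 2 + \<epsilon> * (\<Sum>i\<in>I. (w i - w' i) ^ 2))"
proof -
  have "(1 - t) *\<^sub>R x + t *\<^sub>R x' - bary (\<lambda>i. (1 - t) * w i + t * w' i)
      = (1 - t) *\<^sub>R (x - bary w) + t *\<^sub>R (x' - bary w')"
    unfolding bary_convex_comb by (simp add: algebra_simps)
  then have 1: "norm ((1 - t) *\<^sub>R x + t *\<^sub>R x' - bary (\<lambda>i. (1 - t) * w i + t * w' i)) ^ 2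
      = (1 - t) * norm (x - bary w) ^ 2 + t * norm (x' - bary w') ^ 2
        - t * (1 - t) * norm ((x - bary w) - (x' - bary w')) ^ 2"
    by (simp only: norm_convex_comb_square)
  have "((1 - t) * w i + t * w' i) ^ 2 = (1 - t) * w i ^ 2 + t * w' i ^ 2 - t * (1 - t) * (w i - w' i) ^ 2" for i
    by (simp add: power2_eq_square algebra_simps)
  then have 2: "(\<Sum>i\<in>I. ((1 - t) * w i + t * w' i) ^ 2)
      = (1 - t) * (\<Sum>i\<in>I. w i ^ 2) + t * (\<Sum>i\<in>I. w' i ^ 2) - t * (1 - t) * (\<Sum>i\<in>I. (w i - w' i) ^ 2)"
    by (simp add: sum.distrib sum_subtractf sum_distrib_left)
  have 3: "(\<Sum>i\<in>I. \<phi> i * ((1 - t) * w i + t * w' i)) = (1 - t) * (\<Sum>i\<in>I. \<phi> i * w i) + t * (\<Sum>i\<in>I. \<phi> i * w' i)"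
    by (simp add: distrib_left sum.distrib sum_distrib_left mult_ac)
  show ?thesis unfolding F_def 1 2 3 by (simp add: algebra_simps)
qed

text \<open>The minimizer is compared with points on the segment from it towards \<open>w\<close>;
  after division by \<open>t\<close> the defect keeps the factor \<open>1 - t\<close>, which tends
  to one.\<close>

lemma F_strong_convex:
  assumes w: "w \<in> weights"
  shows "q \<phi> x + (norm (bary (W \<phi> x) - bary w) ^ 2 + \<epsilon> * (\<Sum>i\<in>I. (W \<phi> x i - w i) ^ 2)) \<le> F \<phi> x w"
proof -
  let ?D = "norm (bary (W \<phi> x) - bary w) ^ 2 + \<epsilon> * (\<Sum>i\<in>I. (W \<phi> x i - w i) ^ 2)"
  have "?D \<le> F \<phi> x w - q \<phi> x"
  proof (rule field_le_mult_one_interval)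
    fix s :: real assume s: "0 < s" "s < 1"
    define t where "t = 1 - s"
    have t: "0 < t" "t < 1" using s by (auto simp: t_def)
    have "q \<phi> x \<le> F \<phi> x (\<lambda>i. (1 - t) * W \<phi> x i + t * w i)"
      using t by (intro W weights_convex w) auto
    also have "\<dots> = F \<phi> ((1 - t) *\<^sub>R x + t *\<^sub>R x) (\<lambda>i. (1 - t) * W \<phi> x i + t * w i)"
      by (simp flip: scaleR_add_left)
    also have "\<dots> = (1 - t) * q \<phi> x + t * F \<phi> x w - t * (1 - t) * ?D"
      unfolding F_convex_comb q_def by (simp add: norm_minus_commute)
    finally have "t * (q \<phi> x + (1 - t) * ?D) \<le> t * F \<phi> x w"
      by (simp add: algebra_simps)
    then have "q \<phi> x + (1 - t) * ?D \<le> F \<phi> x w" using t by simp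
    then show "s * ?D \<le> F \<phi> x w - q \<phi> x" by (simp add: t_def)
  qed
  then show ?thesis by simp
qed

text \<open>The strong convexity bounds at \<open>x\<close> and \<open>x'\<close>, each tested with
  the other minimizer, are added. What survives is a cross term, linear in \<open>x - x'\<close> and
  in the difference of barycentres; Young's inequality splits it, and the squared difference of
  barycentres on the left absorbs its part.\<close>

lemma continuous_on_W: "continuous_on UNIV (\<lambda>x. W \<phi> x i)"
proof (cases "i \<in> I")
  case True
  have "(sqrt (1 / \<epsilon>))-lipschitz_on UNIV (\<lambda>x. W \<phi> x i)"
  proof (rule lipschitz_onI)
    fix x x' :: 'a
    let ?w = "W \<phi> x" and ?w' = "W \<phi> x'"
    define N where "N = norm (bary ?w - bary ?w')"
    define S where "S = \<epsilon> * (\<Sum>i\<in>I. (?w i - ?w' i) ^ 2)"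
    have "q \<phi> x + (N ^ 2 + S) \<le> F \<phi> x ?w'"
      using F_strong_convex[OF W(1)] by (simp add: N_def S_def)
    moreover have "q \<phi> x' + (N ^ 2 + S) \<le> F \<phi> x' ?w"
      using F_strong_convex[OF W(1), of \<phi> x' \<phi> x] by (simp add: N_def S_def norm_minus_commute power2_commute)
    moreover have diff: "F \<phi> x w - F \<phi> x' w = norm x ^ 2 - norm x' ^ 2 - 2 * ((x - x') \<bullet> bary w)" for w
      unfolding F_def power2_norm_eq_inner by (simp add: inner_simps inner_commute algebra_simps)
    ultimately have "2 * N ^ 2 + 2 * S \<le> 2 * ((x - x') \<bullet> bary ?w) - 2 * ((x - x') \<bullet> bary ?w')"
      using diff[of ?w] diff[of ?w'] unfolding q_def by linarith
    also have "\<dots> = 2 * ((x - x') \<bullet> (bary ?w - bary ?w'))" by (simp add: inner_diff_right)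
    also have "\<dots> \<le> 2 * (norm (x - x') * N)"
      unfolding N_def by (intro mult_left_mono Cauchy_Schwarz_ineq2[THEN abs_le_D1]) auto
    also have "\<dots> \<le> norm (x - x') ^ 2 + N ^ 2"
      using sum_squares_bound[of "norm (x - x')" N] by simp
    finally have "S \<le> norm (x - x') ^ 2" 
      using zero_le_power2[of N] zero_le_power2[of "norm (x - x')"] by linarith
    moreover have "\<epsilon> * (?w i - ?w' i) ^ 2 \<le> S"
      unfolding S_def using eps True finite_I member_le_sum[of i I "\<lambda>i. (?w i - ?w' i) ^ 2"]
      by (intro mult_left_mono) auto
    ultimately have "\<epsilon> * (?w i - ?w' i) ^ 2 \<le> norm (x - x') ^ 2" by simp
    then have "(?w i - ?w' i) ^ 2 \<le> 1 / \<epsilon> * norm (x - x') ^ 2"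
      using eps by (simp add: field_simps)
    then have "sqrt ((?w i - ?w' i) ^ 2) \<le> sqrt (1 / \<epsilon> * norm (x - x') ^ 2)"
      by (rule real_sqrt_le_mono)
    then show "dist (?w i) (?w' i) \<le> sqrt (1 / \<epsilon>) * dist x x'"
      unfolding real_sqrt_mult by (simp add: dist_real_def dist_norm)
  qed (use eps in auto)
  then show ?thesis by (rule lipschitz_on_continuous_on)
next
  case False
  then show ?thesis using weightsD(3)[OF W(1)] by simp
qed

lemma continuous_on_bary_W: "continuous_on UNIV (\<lambda>x. bary (W \<phi> x))"
  unfolding bary_def by (intro continuous_intros continuous_on_W)

lemma continuous_on_q: "continuous_on UNIV (q \<phi>)"
  unfolding q_def F_def by (intro continuous_intros continuous_on_W continuous_on_bary_W)

lemma norm_bary_le: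
  assumes "w \<in> weights"
  shows "norm (bary w) \<le> R"
  unfolding bary_def R_def
proof (rule sum_norm_le)
  fix i show "norm (w i *\<^sub>R y i) \<le> norm (y i)"
    using weightsD(1,2)[OF assms, of i] by (simp add: mult_left_le_one_le)
qed

lemma norm_square_diff_bary_le:
  assumes "w \<in> weights"
  shows "norm (x - bary w) ^ 2 \<le> 2 * norm x ^ 2 + 2 * R ^ 2"
proof -
  have "norm (bary w) ^ 2 \<le> R ^ 2" using norm_bary_le[OF assms] by (intro power_mono) auto
  then show ?thesis using norm_diff_square_le[of x "bary w"] by simp
qed

definition K :: "('i \<Rightarrow> real) \<Rightarrow> real" where
  "K \<phi> = 2 + 2 * R ^ 2 + \<epsilon> * card I + (\<Sum>i\<in>I. \<bar>\<phi> i\<bar>)"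

lemma K_nonneg: "0 \<le> K \<phi>"
  unfolding K_def using eps by (intro add_nonneg_nonneg sum_nonneg) auto

lemma abs_F_le:
  assumes w: "w \<in> weights"
  shows "\<bar>F \<phi> x w\<bar> \<le> K \<phi> * (1 + norm x ^ 2)"
proof -
  have "(\<Sum>i\<in>I. w i ^ 2) \<le> (\<Sum>i\<in>I. 1)"
    using weightsD(1,2)[OF w] by (intro sum_mono power_le_one)
  then have 1: "\<epsilon> * (\<Sum>i\<in>I. w i ^ 2) \<le> \<epsilon> * card I"
    using eps by (intro mult_left_mono) auto
  have 2: "0 \<le> \<epsilon> * (\<Sum>i\<in>I. w i ^ 2)" using eps by (intro mult_nonneg_nonneg sum_nonneg) auto
  have "\<bar>\<Sum>i\<in>I. \<phi> i * w i\<bar> \<le> (\<Sum>i\<in>I. \<bar>\<phi> i\<bar>)"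
    using weightsD(1,2)[OF w] by (intro order_trans[OF sum_abs sum_mono]) (auto simp: abs_mult mult_left_le)
  then have "\<bar>F \<phi> x w\<bar> \<le> (2 * norm x ^ 2 + 2 * R ^ 2) + \<epsilon> * card I + (\<Sum>i\<in>I. \<bar>\<phi> i\<bar>)"
    using 1 2 norm_square_diff_bary_le[OF w, of x] zero_le_power2[of "norm (x - bary w)"] unfolding F_def by linarith
  also have "\<dots> \<le> K \<phi> + K \<phi> * norm x ^ 2"
  proof (rule order_trans)
    show "2 * norm x ^ 2 + 2 * R ^ 2 + \<epsilon> * card I + (\<Sum>i\<in>I. \<bar>\<phi> i\<bar>) \<le> K \<phi> + 2 * norm x ^ 2"
      unfolding K_def by simp
    have "2 \<le> K \<phi>" unfolding K_def using eps by (auto intro!: add_nonneg_nonneg sum_nonneg)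
    then show "K \<phi> + 2 * norm x ^ 2 \<le> K \<phi> + K \<phi> * norm x ^ 2"
      by (intro add_left_mono mult_right_mono) auto
  qed
  finally show ?thesis by (simp add: algebra_simps)
qed

lemma abs_q_le: "\<bar>q \<phi> x\<bar> \<le> K \<phi> * (1 + norm x ^ 2)"
  unfolding q_def by (intro abs_F_le W)

lemma integrable_q: "integrable \<mu> (q \<phi>)"
  using abs_q_le by (intro P2_integrable_quadratic[OF P2, of _ "K \<phi>"] borel_measurable_continuous_onI continuous_on_q) auto

lemma integrable_W: "integrable \<mu> (\<lambda>x. W \<phi> x i)"
proof (intro P2_integrable_quadratic[OF P2, of _ 1] borel_measurable_continuous_onI continuous_on_W)
  fix x show "norm (W \<phi> x i) \<le> 1 * (1 + (norm x)\<^sup>2)"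
    by (rule order_trans[of _ 1]) (use weightsD(1,2)[OF W(1), of \<phi> x i] in auto)
qed

lemma convex_on_q: "convex_on UNIV (q \<phi>)"
proof (rule convex_onI)
  fix t :: real and x x' :: 'a assume t: "0 < t" "t < 1"
  have "q \<phi> ((1 - t) *\<^sub>R x + t *\<^sub>R x') \<le> F \<phi> ((1 - t) *\<^sub>R x + t *\<^sub>R x') (\<lambda>i. (1 - t) * W \<phi> x i + t * W \<phi> x' i)"
    using t by (intro W weights_convex) auto
  also have "\<dots> \<le> (1 - t) * q \<phi> x + t * q \<phi> x'"
    unfolding F_convex_comb q_def using t eps by (auto intro!: mult_nonneg_nonneg add_nonneg_nonneg sum_nonneg)
  finally show "q \<phi> ((1 - t) *\<^sub>R x + t *\<^sub>R x') \<le> (1 - t) * q \<phi> x + t * q \<phi> x'" .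
qed auto

section \<open>The dual function of the multipliers\<close>

lemma q_lipschitz_multiplier: "q \<phi> x \<le> q \<phi>' x + (\<Sum>i\<in>I. \<bar>\<phi> i - \<phi>' i\<bar>)"
proof -
  have "q \<phi> x \<le> F \<phi> x (W \<phi>' x)" by (intro W)
  also have "\<dots> = q \<phi>' x + (\<Sum>i\<in>I. (\<phi> i - \<phi>' i) * W \<phi>' x i)"
    unfolding q_def F_def by (simp add: left_diff_distrib sum_subtractf)
  also have "(\<Sum>i\<in>I. (\<phi> i - \<phi>' i) * W \<phi>' x i) \<le> (\<Sum>i\<in>I. \<bar>\<phi> i - \<phi>' i\<bar>)"
  proof (intro sum_mono)
    fix i
    have "(\<phi> i - \<phi>' i) * W \<phi>' x i \<le> \<bar>\<phi> i - \<phi>' i\<bar> * W \<phi>' x i"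
      by (intro mult_right_mono weightsD(1)[OF W(1)]) auto
    also have "\<dots> \<le> \<bar>\<phi> i - \<phi>' i\<bar>"
      by (intro mult_left_le weightsD(2)[OF W(1)]) auto
    finally show "(\<phi> i - \<phi>' i) * W \<phi>' x i \<le> \<bar>\<phi> i - \<phi>' i\<bar>" .
  qed
  finally show ?thesis by simp
qed

lemma g_lipschitz: "g \<phi> \<le> g \<phi>' + 2 * (\<Sum>i\<in>I. \<bar>\<phi> i - \<phi>' i\<bar>)"
proof -
  interpret prob_space \<mu> using P2D(1)[OF P2] .
  have "integral\<^sup>L \<mu> (q \<phi>) \<le> (\<integral>x. q \<phi>' x + (\<Sum>i\<in>I. \<bar>\<phi> i - \<phi>' i\<bar>) \<partial>\<mu>)"
    by (intro integral_mono integrable_q Bochner_Integration.integrable_add q_lipschitz_multiplier) auto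
  also have "\<dots> = integral\<^sup>L \<mu> (q \<phi>') + (\<Sum>i\<in>I. \<bar>\<phi> i - \<phi>' i\<bar>)"
    by (simp add: integrable_q prob_space)
  moreover have "(\<Sum>i\<in>I. \<phi>' i * p i) - (\<Sum>i\<in>I. \<phi> i * p i) \<le> (\<Sum>i\<in>I. \<bar>\<phi> i - \<phi>' i\<bar>)"
    unfolding sum_subtractf[symmetric]
  proof (intro sum_mono)
    fix i assume i: "i \<in> I"
    have "\<phi>' i * p i - \<phi> i * p i = (\<phi>' i - \<phi> i) * p i" by (simp add: algebra_simps)
    also have "\<dots> \<le> \<bar>\<phi> i - \<phi>' i\<bar> * p i"
      using p_pos[OF i] by (intro mult_right_mono) auto
    also have "\<dots> \<le> \<bar>\<phi> i - \<phi>' i\<bar>"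
      using p_le_1[OF i] by (intro mult_left_le) auto
    finally show "\<phi>' i * p i - \<phi> i * p i \<le> \<bar>\<phi> i - \<phi>' i\<bar>" .
  qed
  ultimately show ?thesis unfolding g_def by linarith
qed

lemma continuous_on_g: "continuous_on S g"
proof -
  have c: "continuous_on UNIV (\<lambda>w. w i)" for i :: 'i
    by (rule continuous_on_product_coordinates)
  have "(g \<longlongrightarrow> g \<phi>) (at \<phi>)" for \<phi>
  proof -
    have "continuous_on UNIV (\<lambda>\<phi>'. 2 * (\<Sum>i\<in>I. \<bar>\<phi>' i - \<phi> i\<bar>))"
      by (intro continuous_intros c)
    then have "((\<lambda>\<phi>'. 2 * (\<Sum>i\<in>I. \<bar>\<phi>' i - \<phi> i\<bar>)) \<longlongrightarrow> 2 * (\<Sum>i\<in>I. \<bar>\<phi> i - \<phi> i\<bar>)) (at \<phi>)"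
      by (rule continuous_on_def[THEN iffD1, rule_format, OF _ UNIV_I])
    then have "((\<lambda>\<phi>'. 2 * (\<Sum>i\<in>I. \<bar>\<phi>' i - \<phi> i\<bar>)) \<longlongrightarrow> 0) (at \<phi>)" by simp
    moreover have "norm (g \<phi>' - g \<phi>) \<le> 2 * (\<Sum>i\<in>I. \<bar>\<phi>' i - \<phi> i\<bar>)" for \<phi>'
      using g_lipschitz[of \<phi> \<phi>'] g_lipschitz[of \<phi>' \<phi>] by (simp add: abs_minus_commute abs_le_iff)
    ultimately have "((\<lambda>\<phi>'. g \<phi>' - g \<phi>) \<longlongrightarrow> 0) (at \<phi>)"
      by (rule Lim_null_comparison[OF always_eventually[OF allI], rotated])
    then show ?thesis by (rule Lim_null[THEN iffD2])
  qed
  then have "continuous_on UNIV g" by (simp add: continuous_on_def)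
  then show ?thesis by (rule continuous_on_subset) auto
qed

lemma g_zero_nonneg: "0 \<le> g (\<lambda>_. 0)"
proof -
  have "0 \<le> q (\<lambda>_. 0) x" for x
    unfolding q_def F_def using eps by (auto intro!: add_nonneg_nonneg mult_nonneg_nonneg sum_nonneg)
  then show ?thesis unfolding g_def by simp
qed

text \<open>The dual function is invariant under adding constants to the multipliers and tends to minus
  infinity with their oscillation, so it attains its maximum.\<close>
lemma g_attains_max: "\<exists>\<phi>. \<forall>\<phi>'. g \<phi>' \<le> g \<phi>"
proof -
  interpret prob_space \<mu> using P2D(1)[OF P2] .
  \<comment> \<open>\<open>A\<close> bounds the integral of \<open>q \<psi>\<close> whenever
    \<open>\<psi>\<close> vanishes at some index of \<open>I\<close>, by the weight concentrated
    there. With \<open>M = A / pm\<close>, a nonnegative \<open>\<psi>\<close> exceeding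
    \<open>M\<close> somewhere in \<open>I\<close> loses at least \<open>A\<close> in the linear
    term, so \<open>g \<psi> \<le> 0\<close>, no better than zero multipliers.\<close>
  define A where "A = 2 * (\<integral>x. norm x ^ 2 \<partial>\<mu>) + 2 * R ^ 2 + \<epsilon>"
  define pm where "pm = Min (p ` I)"
  have pm: "0 < pm" "\<And>i. i \<in> I \<Longrightarrow> pm \<le> p i"
    unfolding pm_def using finite_I I_nonempty p_pos by auto
  define M where "M = A / pm"
  have "0 \<le> A" unfolding A_def using eps by (intro add_nonneg_nonneg) auto
  then have M: "0 \<le> M" "pm * M = A" using pm(1) by (auto simp: M_def)
  define B where "B = PiE UNIV (\<lambda>_::'i. {0..M})"
  have "compact B" unfolding B_def by (intro compact_PiE_UNIV) auto
  moreover have zero: "(\<lambda>_. 0) \<in> B" using M by (auto simp: B_def)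
  ultimately obtain \<phi> where \<phi>: "\<phi> \<in> B" "\<And>\<phi>'. \<phi>' \<in> B \<Longrightarrow> g \<phi>' \<le> g \<phi>"
    using continuous_attains_sup[of B g] continuous_on_g by auto
  have "g \<phi>' \<le> g \<phi>" for \<phi>'
  proof -
    define m where "m = Min (\<phi>' ` I)"
    have m: "\<And>i. i \<in> I \<Longrightarrow> m \<le> \<phi>' i" unfolding m_def using finite_I by auto
    have "m \<in> \<phi>' ` I" unfolding m_def using finite_I I_nonempty by (intro Min_in) auto
    then obtain i0 where i0: "i0 \<in> I" "\<phi>' i0 = m" by auto
    \<comment> \<open>Subtracting the minimum yields nonnegative multipliers with a zero at
      \<open>i0\<close>. The value off \<open>I\<close> is set to zero so that \<open>\<psi>\<close>
      can belong to the box over the whole index type.\<close>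
    define \<psi> where "\<psi> = (\<lambda>i. if i \<in> I then \<phi>' i - m else 0)"
    have shift: "(\<Sum>i\<in>I. \<psi> i * w i) = (\<Sum>i\<in>I. \<phi>' i * w i) - m * sum w I" for w :: "'i \<Rightarrow> real"
      unfolding \<psi>_def sum_distrib_left sum_subtractf[symmetric] by (intro sum.cong) (auto simp: algebra_simps)
    have "q \<phi>' x \<le> q \<psi> x + m" for x
    proof -
      have "q \<phi>' x \<le> F \<phi>' x (W \<psi> x)" by (intro W)
      also have "\<dots> = q \<psi> x + m" unfolding q_def F_def shift by (simp add: weightsD(4)[OF W(1)])
      finally show ?thesis .
    qed
    then have "integral\<^sup>L \<mu> (q \<phi>') \<le> (\<integral>x. q \<psi> x + m \<partial>\<mu>)"
      by (intro integral_mono integrable_q Bochner_Integration.integrable_add) auto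
    also have "\<dots> = integral\<^sup>L \<mu> (q \<psi>) + m" by (simp add: integrable_q prob_space)
    finally have le: "g \<phi>' \<le> g \<psi>" unfolding g_def shift by (simp add: sum_p)
    show ?thesis
    proof (cases "\<forall>i\<in>I. \<psi> i \<le> M")
      case True
      then have "\<psi> \<in> B" using m M by (auto simp: B_def \<psi>_def PiE_iff)
      then show ?thesis using le \<phi>(2) by (meson order_trans)
    next
      case False
      then obtain j where j: "j \<in> I" "M < \<psi> j" by auto
      have \<psi>0: "0 \<le> \<psi> i" for i using m by (auto simp: \<psi>_def)
      have "q \<psi> x \<le> 2 * norm x ^ 2 + (2 * R ^ 2 + \<epsilon>)" for x
      proof -
        have "q \<psi> x \<le> F \<psi> x (vertex i0)" by (intro W vertex_weights i0)
        also have "\<dots> = norm (x - bary (vertex i0)) ^ 2 + \<epsilon>"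
          using i0 by (simp add: F_vertex bary_vertex \<psi>_def)
        also have "\<dots> \<le> 2 * norm x ^ 2 + (2 * R ^ 2 + \<epsilon>)"
          using norm_square_diff_bary_le[OF vertex_weights[OF i0(1)], of x] by simp
        finally show ?thesis .
      qed
      then have "integral\<^sup>L \<mu> (q \<psi>) \<le> (\<integral>x. 2 * norm x ^ 2 + (2 * R ^ 2 + \<epsilon>) \<partial>\<mu>)"
        using P2D(4)[OF P2] by (intro integral_mono integrable_q Bochner_Integration.integrable_add) auto
      also have "\<dots> = A" using P2D(4)[OF P2] by (simp add: A_def prob_space)
      finally have 1: "integral\<^sup>L \<mu> (q \<psi>) \<le> A" .
      have "A = pm * M" using M by simp
      also have "\<dots> \<le> p j * \<psi> j" using pm j M by (intro mult_mono) (auto intro: less_imp_le order_trans)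
      also have "\<dots> = \<psi> j * p j" by simp
      also have "\<dots> \<le> (\<Sum>i\<in>I. \<psi> i * p i)"
        using j finite_I \<psi>0 p_pos by (intro member_le_sum mult_nonneg_nonneg) (auto intro: less_imp_le)
      finally have "g \<psi> \<le> 0" using 1 unfolding g_def by simp
      then show ?thesis using le g_zero_nonneg \<phi>(2)[OF zero] by simp
    qed
  qed
  then show ?thesis by blast
qed

text \<open>The first-order condition at a maximizer says that the weights have the prescribed means.\<close>
lemma integral_W_at_max:
  assumes max: "\<And>\<phi>'. g \<phi>' \<le> g \<phi>" and j: "j \<in> I"
  shows "(\<integral>x. W \<phi> x j \<partial>\<mu>) = p j"
proof -
  interpret prob_space \<mu> using P2D(1)[OF P2] .
  \<comment> \<open>Perturbing one multiplier by \<open>s * t\<close> changes \<open>q\<close> by at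
    least the linear term minus \<open>t^2 / (4 * \<epsilon>)\<close>, the loss allowed by strong
    convexity. Maximality turns this into a bound of order \<open>t\<close>; as \<open>t\<close>
    tends to zero, the two signs of \<open>s\<close> give the equality.\<close>
  have main: "s * ((\<integral>x. W \<phi> x j \<partial>\<mu>) - p j) \<le> t / (4 * \<epsilon>)" if t: "0 < t" and s: "\<bar>s\<bar> = 1" for s t :: real
  proof -
    define \<psi> where "\<psi> = \<phi>(j := \<phi> j + s * t)"
    have shift: "(\<Sum>i\<in>I. \<psi> i * w i) = (\<Sum>i\<in>I. \<phi> i * w i) + s * t * w j" for w :: "'i \<Rightarrow> real"
      unfolding \<psi>_def using j finite_I by (simp add: sum.remove[of I j] algebra_simps)
    have "q \<phi> x + s * t * W \<phi> x j - t ^ 2 / (4 * \<epsilon>) \<le> q \<psi> x" for x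
    proof -
      define d where "d = W \<phi> x j - W \<psi> x j"
      have "\<epsilon> * d ^ 2 \<le> \<epsilon> * (\<Sum>i\<in>I. (W \<phi> x i - W \<psi> x i) ^ 2)"
        unfolding d_def using eps j finite_I member_le_sum[of j I "\<lambda>i. (W \<phi> x i - W \<psi> x i) ^ 2"]
        by (intro mult_left_mono) auto
      then have "q \<phi> x + \<epsilon> * d ^ 2 \<le> F \<phi> x (W \<psi> x)"
        using F_strong_convex[OF W(1), of \<phi> x \<psi> x] zero_le_power2[of "norm (bary (W \<phi> x) - bary (W \<psi> x))"] by linarith
      also have "\<dots> = q \<psi> x - s * t * W \<psi> x j"
        unfolding q_def F_def shift by simp
      finally have 1: "q \<phi> x + \<epsilon> * d ^ 2 + s * t * W \<psi> x j \<le> q \<psi> x" by simp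
      \<comment> \<open>The deviation \<open>d\<close> of the perturbed minimizer is not known
        explicitly, so it is eliminated by completing the square.\<close>
      have "0 \<le> \<epsilon> * (d - s * t / (2 * \<epsilon>)) ^ 2" using eps by simp
      also have "\<dots> = \<epsilon> * d ^ 2 - s * t * d + s ^ 2 * t ^ 2 / (4 * \<epsilon>)"
        using eps by (simp add: power2_diff power_divide power_mult_distrib field_simps) (simp add: power2_eq_square)
      also have "s ^ 2 = 1" using s by (metis power2_abs power_one)
      finally have "s * t * d - t ^ 2 / (4 * \<epsilon>) \<le> \<epsilon> * d ^ 2" by simp
      moreover have "s * t * W \<phi> x j = s * t * d + s * t * W \<psi> x j" by (simp add: d_def algebra_simps)
      ultimately show ?thesis using 1 by linarith
    qed
    then have "(\<integral>x. q \<phi> x + s * t * W \<phi> x j - t ^ 2 / (4 * \<epsilon>) \<partial>\<mu>) \<le> integral\<^sup>L \<mu> (q \<psi>)"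
      by (intro integral_mono integrable_q Bochner_Integration.integrable_add
          Bochner_Integration.integrable_diff integrable_W integrable_mult_right) auto
    then have "integral\<^sup>L \<mu> (q \<phi>) + s * t * (\<integral>x. W \<phi> x j \<partial>\<mu>) - t ^ 2 / (4 * \<epsilon>) \<le> integral\<^sup>L \<mu> (q \<psi>)"
      by (simp add: integrable_q integrable_W prob_space)
    moreover have "g \<psi> \<le> g \<phi>" by (rule max)
    ultimately have "t * (s * ((\<integral>x. W \<phi> x j \<partial>\<mu>) - p j)) \<le> t * (t / (4 * \<epsilon>))"
      unfolding g_def shift by (simp add: algebra_simps power2_eq_square)
    then show ?thesis using t by (rule mult_left_le_imp_le)
  qed
  have "s * ((\<integral>x. W \<phi> x j \<partial>\<mu>) - p j) \<le> 0" if s: "\<bar>s\<bar> = 1" for s :: real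
  proof (rule field_le_epsilon)
    fix e :: real assume "0 < e"
    then show "s * ((\<integral>x. W \<phi> x j \<partial>\<mu>) - p j) \<le> 0 + e"
      using main[of "4 * \<epsilon> * e" s] eps s by simp
  qed
  from this[of 1] this[of "- 1"] show ?thesis by simp
qed

text \<open>With exact means the multiplier term of \<open>q\<close> integrates to
  \<open>\<Sum>i\<in>I. \<phi> i * p i\<close> and cancels in \<open>g\<close>; what remains is the
  cost plus the nonnegative regularization.\<close>

lemma cost_le_g:
  assumes "\<And>j. j \<in> I \<Longrightarrow> (\<integral>x. W \<phi> x j \<partial>\<mu>) = p j"
  shows "(\<integral>x. norm (x - bary (W \<phi> x)) ^ 2 \<partial>\<mu>) \<le> g \<phi>"
proof -
  have "integrable \<mu> (\<lambda>x. norm (x - bary (W \<phi> x)) ^ 2)"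
  proof (intro P2_integrable_quadratic[OF P2, of _ "2 + 2 * R ^ 2"] borel_measurable_continuous_onI continuous_intros continuous_on_bary_W)
    fix x
    have "norm (norm (x - bary (W \<phi> x)) ^ 2) \<le> 2 * norm x ^ 2 + 2 * R ^ 2"
      using norm_square_diff_bary_le[OF W(1), of x] by simp
    then show "norm (norm (x - bary (W \<phi> x)) ^ 2) \<le> (2 + 2 * R ^ 2) * (1 + norm x ^ 2)"
      using mult_nonneg_nonneg[OF zero_le_power2[of R] zero_le_power2[of "norm x"]]
      unfolding distrib_left distrib_right mult_1_right by linarith
  qed
  moreover have "integrable \<mu> (\<lambda>x. \<Sum>i\<in>I. \<phi> i * W \<phi> x i)"
    by (intro Bochner_Integration.integrable_sum integrable_mult_right integrable_W)
  ultimately have "(\<integral>x. norm (x - bary (W \<phi> x)) ^ 2 \<partial>\<mu>) + (\<integral>x. (\<Sum>i\<in>I. \<phi> i * W \<phi> x i) \<partial>\<mu>) =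
      (\<integral>x. norm (x - bary (W \<phi> x)) ^ 2 + (\<Sum>i\<in>I. \<phi> i * W \<phi> x i) \<partial>\<mu>)"
    "integrable \<mu> (\<lambda>x. norm (x - bary (W \<phi> x)) ^ 2 + (\<Sum>i\<in>I. \<phi> i * W \<phi> x i))"
    by simp_all
  moreover have "(\<integral>x. norm (x - bary (W \<phi> x)) ^ 2 + (\<Sum>i\<in>I. \<phi> i * W \<phi> x i) \<partial>\<mu>) \<le> integral\<^sup>L \<mu> (q \<phi>)"
    using calculation(2) integrable_q eps
    by (intro integral_mono) (auto simp: q_def F_def intro!: mult_nonneg_nonneg sum_nonneg)
  moreover have "(\<integral>x. (\<Sum>i\<in>I. \<phi> i * W \<phi> x i) \<partial>\<mu>) = (\<Sum>i\<in>I. \<phi> i * p i)"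
    by (simp add: Bochner_Integration.integral_sum integrable_W assms)
  ultimately show ?thesis unfolding g_def by simp
qed

end

text \<open>Of the minimality of \<open>q\<close> only the tests at the vertices of the simplex are
  exported: they bound \<open>q\<close> by the cost to each single target, the form in which the
  transform can be estimated.\<close>

lemma barycentric_duality:
  fixes \<mu> :: "'a::euclidean_space measure" and y :: "'i \<Rightarrow> 'a" and p :: "'i \<Rightarrow> real"
  assumes "\<mu> \<in> P2" "finite I" "\<And>i. i \<in> I \<Longrightarrow> 0 < p i" "sum p I = 1" "0 < \<epsilon>"
  obtains w q \<phi> C where
    "\<And>i. continuous_on UNIV (\<lambda>x. w x i)" "\<And>x i. 0 \<le> w x i" "\<And>x. (\<Sum>i\<in>I. w x i) = 1"
    "\<And>i. i \<in> I \<Longrightarrow> (\<integral>x. w x i \<partial>\<mu>) = p i"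
    "convex_on UNIV q" "0 \<le> C" "\<And>x. \<bar>q x\<bar> \<le> C * (1 + norm x ^ 2)"
    "\<And>x i. i \<in> I \<Longrightarrow> q x \<le> norm (x - y i) ^ 2 + \<epsilon> + \<phi> i"
    "(\<integral>x. norm (x - (\<Sum>i\<in>I. w x i *\<^sub>R y i)) ^ 2 \<partial>\<mu>) \<le> integral\<^sup>L \<mu> q - (\<Sum>i\<in>I. \<phi> i * p i)"
proof -
  interpret barycentric_problem \<mu> I y p \<epsilon>
    using assms by unfold_locales
  obtain \<phi> where \<phi>: "\<And>\<phi>'. g \<phi>' \<le> g \<phi>" using g_attains_max by blast
  have EW: "\<And>i. i \<in> I \<Longrightarrow> (\<integral>x. W \<phi> x i \<partial>\<mu>) = p i" by (rule integral_W_at_max[OF \<phi>])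
  show thesis
  proof (rule that[of "W \<phi>" "q \<phi>" "K \<phi>" \<phi>])
    fix x i assume "i \<in> I"
    then show "q \<phi> x \<le> norm (x - y i) ^ 2 + \<epsilon> + \<phi> i"
      using W(2)[OF vertex_weights, of i \<phi> x] by (simp add: F_vertex)
  qed (use continuous_on_W weightsD[OF W(1)] EW convex_on_q K_nonneg abs_q_le cost_le_g[OF EW] in \<open>auto simp: bary_def g_def\<close>)
qed

section \<open>Couplings with a density\<close>

lemma P2_distr:
  assumes "prob_space M" and [measurable]: "T \<in> M \<rightarrow>\<^sub>M borel" and "integrable M (\<lambda>x. norm (T x) ^ 2)"
  shows "distr M borel T \<in> P2"
  using assms(1,3) unfolding P2_def
  by (auto simp: integrable_distr_eq intro!: prob_space.prob_space_distr)

lemma T2_distr_le: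
  fixes S T :: "'b \<Rightarrow> 'a::euclidean_space"
  assumes "prob_space M" and [measurable]: "S \<in> M \<rightarrow>\<^sub>M borel" "T \<in> M \<rightarrow>\<^sub>M borel"
  shows "T2 (distr M borel S) (distr M borel T) \<le> enn2ereal (\<integral>\<^sup>+x. ennreal (norm (S x - T x) ^ 2) \<partial>M)"
proof -
  let ?\<pi> = "distr M (borel \<Otimes>\<^sub>M borel) (\<lambda>x. (S x, T x))"
  have "?\<pi> \<in> couplings (distr M borel S) (distr M borel T)"
    using assms(1) unfolding couplings_def
    by (auto simp: distr_distr comp_def intro!: prob_space.prob_space_distr)
  then have "T2 (distr M borel S) (distr M borel T) \<le> enn2ereal (\<integral>\<^sup>+z. ennreal (norm (fst z - snd z) ^ 2) \<partial>?\<pi>)"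
    unfolding T2_def by (rule INF_lower)
  also have "\<dots> = enn2ereal (\<integral>\<^sup>+x. ennreal (norm (S x - T x) ^ 2) \<partial>M)"
    by (subst nn_integral_distr) auto
  finally show ?thesis .
qed

text \<open>\<open>H\<close> is the density of a coupling of \<open>\<mu>\<close> and \<open>\<nu>\<close> with respect to their product and
  \<open>b x\<close> is the conditional mean of the second coordinate.\<close>
locale density_coupling =
  fixes \<mu> \<nu> :: "'a::euclidean_space measure" and H :: "'a \<Rightarrow> 'a \<Rightarrow> real" and b :: "'a \<Rightarrow> 'a" and K R :: real
  assumes P2: "\<mu> \<in> P2" "\<nu> \<in> P2"
    and H_measurable: "case_prod H \<in> borel_measurable (borel \<Otimes>\<^sub>M borel)"
    and H_nonneg: "\<And>x y. 0 \<le> H x y" and H_le: "\<And>x y. H x y \<le> K"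
    and marginal_1: "\<And>x. (\<integral>y. H x y \<partial>\<nu>) = 1" and marginal_2: "\<And>y. (\<integral>x. H x y \<partial>\<mu>) = 1"
    and b_measurable: "b \<in> borel_measurable borel" and b_le: "\<And>x. norm (b x) \<le> R"
    and b_eq: "\<And>x. (\<integral>y. H x y *\<^sub>R y \<partial>\<nu>) = b x"
begin

sublocale mu: prob_space \<mu> using P2D(1)[OF P2(1)] .
sublocale nu: prob_space \<nu> using P2D(1)[OF P2(2)] .
sublocale pair_prob_space \<mu> \<nu> ..

declare P2D(2)[OF P2(1), measurable_cong] P2D(2)[OF P2(2), measurable_cong]
declare H_measurable[measurable] b_measurable[measurable]

definition \<pi> :: "('a \<times> 'a) measure" where
  "\<pi> = density (\<mu> \<Otimes>\<^sub>M \<nu>) (\<lambda>z. ennreal (case_prod H z))"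

lemma sets_\<pi>[measurable_cong]: "sets \<pi> = sets (borel \<Otimes>\<^sub>M borel)"
  unfolding \<pi>_def using sets_pair_measure_cong[OF P2D(2)[OF P2(1)] P2D(2)[OF P2(2)]] by simp

lemma measurable_H_fst[measurable]: "(\<lambda>x. H x y) \<in> borel_measurable borel"
  and measurable_H_snd[measurable]: "H x \<in> borel_measurable borel"
proof -
  have "(\<lambda>x. case_prod H (x, y)) \<in> borel_measurable borel" "(\<lambda>y. case_prod H (x, y)) \<in> borel_measurable borel" by measurable
  then show "(\<lambda>x. H x y) \<in> borel_measurable borel" "H x \<in> borel_measurable borel" by simp_all
qed

lemma integrable_H: "integrable \<nu> (H x)" "integrable \<mu> (\<lambda>x. H x y)"
  using H_nonneg H_le
  by (auto intro!: nu.integrable_const_bound[of _ K] mu.integrable_const_bound[of _ K])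

lemma nn_integral_H: "(\<integral>\<^sup>+y. ennreal (H x y) \<partial>\<nu>) = 1" "(\<integral>\<^sup>+x. ennreal (H x y) \<partial>\<mu>) = 1"
  using nn_integral_eq_integral[OF integrable_H(1)] nn_integral_eq_integral[OF integrable_H(2)]
    H_nonneg marginal_1 marginal_2 by auto

lemma distr_fst: "distr \<pi> borel fst = \<mu>"
proof (rule measure_eqI)
  fix A assume "A \<in> sets (distr \<pi> borel fst)"
  then have [measurable]: "A \<in> sets borel" by simp
  have "emeasure (distr \<pi> borel fst) A = (\<integral>\<^sup>+z. ennreal (case_prod H z) * indicator A (fst z) \<partial>(\<mu> \<Otimes>\<^sub>M \<nu>))"
    by (subst nn_integral_indicator[symmetric], simp, subst nn_integral_distr, simp, simp)
       (simp add: \<pi>_def nn_integral_density)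
  also have "\<dots> = (\<integral>\<^sup>+x. \<integral>\<^sup>+y. ennreal (H x y) * indicator A x \<partial>\<nu> \<partial>\<mu>)"
    by (subst nu.nn_integral_fst[symmetric]) auto
  also have "\<dots> = (\<integral>\<^sup>+x. indicator A x \<partial>\<mu>)"
    by (simp add: nn_integral_multc nn_integral_H)
  also have "\<dots> = emeasure \<mu> A" by (intro nn_integral_indicator) simp
  finally show "emeasure (distr \<pi> borel fst) A = emeasure \<mu> A" .
qed (simp add: P2D(2)[OF P2(1)])

lemma distr_snd: "distr \<pi> borel snd = \<nu>"
proof (rule measure_eqI)
  fix A assume "A \<in> sets (distr \<pi> borel snd)"
  then have [measurable]: "A \<in> sets borel" by simp
  have "emeasure (distr \<pi> borel snd) A = (\<integral>\<^sup>+z. ennreal (case_prod H z) * indicator A (snd z) \<partial>(\<mu> \<Otimes>\<^sub>M \<nu>))"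
    by (subst nn_integral_indicator[symmetric], simp, subst nn_integral_distr, simp, simp)
       (simp add: \<pi>_def nn_integral_density)
  also have "\<dots> = (\<integral>\<^sup>+y. \<integral>\<^sup>+x. ennreal (H x y) * indicator A y \<partial>\<mu> \<partial>\<nu>)"
    by (subst nn_integral_snd[symmetric]) auto
  also have "\<dots> = (\<integral>\<^sup>+y. indicator A y \<partial>\<nu>)"
    by (simp add: nn_integral_multc nn_integral_H)
  also have "\<dots> = emeasure \<nu> A" by (intro nn_integral_indicator) simp
  finally show "emeasure (distr \<pi> borel snd) A = emeasure \<nu> A" .
qed (simp add: P2D(2)[OF P2(2)])

lemma prob_space_\<pi>: "prob_space \<pi>"
  by (rule prob_space_distrD[of fst _ borel]) (auto simp: distr_fst P2D(1)[OF P2(1)])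

lemma integrable_fst_snd:
  fixes f :: "'a \<Rightarrow> real"
  shows "integrable \<mu> f \<Longrightarrow> integrable \<pi> (\<lambda>z. f (fst z))"
    "integrable \<nu> f \<Longrightarrow> integrable \<pi> (\<lambda>z. f (snd z))"
  using integrable_distr[of fst \<pi> borel f] integrable_distr[of snd \<pi> borel f] by (simp_all add: distr_fst distr_snd)

lemma integrable_b: "integrable \<mu> (\<lambda>x. norm (b x) ^ 2)"
  using b_le by (intro mu.integrable_const_bound[of _ "R ^ 2"]) (auto intro!: power_mono)

text \<open>An affine minorant of \<open>f\<close> touching at \<open>z\<close> is integrated
  against the probability density \<open>H x\<close>. Its linear part vanishes, since
  \<open>z + y - b x\<close> has mean \<open>z\<close>.\<close>

lemma jensen_kernel:
  assumes f: "convex_on UNIV f" and int: "integrable \<nu> (\<lambda>y. H x y * f (z + y - b x))"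
  shows "f z \<le> (\<integral>y. H x y * f (z + y - b x) \<partial>\<nu>)"
proof -
  obtain g where g: "\<And>v. f z + g \<bullet> (v - z) \<le> f v" using convex_on_imp_subgradient[OF f] by blast
  have "integrable \<nu> (\<lambda>y. norm y)"
    by (intro P2_integrable_quadratic[OF P2(2), of _ 1]) (auto simp: norm_le_one_plus_square)
  then have "integrable \<nu> (\<lambda>y. K * norm y)" by (rule integrable_mult_right)
  then have Hy: "integrable \<nu> (\<lambda>y. H x y *\<^sub>R y)"
    by (rule Bochner_Integration.integrable_bound)
       (use H_nonneg H_le in \<open>auto intro!: AE_I2 mult_right_mono order_trans[OF _ abs_ge_self]\<close>)
  have "f z = f z * (\<integral>y. H x y \<partial>\<nu>) + (g \<bullet> (\<integral>y. H x y *\<^sub>R y \<partial>\<nu>) - (g \<bullet> b x) * (\<integral>y. H x y \<partial>\<nu>))"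
    by (simp add: marginal_1 b_eq)
  also have "\<dots> = (\<integral>y. f z * H x y + (g \<bullet> (H x y *\<^sub>R y) - (g \<bullet> b x) * H x y) \<partial>\<nu>)"
    using integrable_H Hy by (simp del: inner_scaleR_right)
  also have "\<dots> \<le> (\<integral>y. H x y * f (z + y - b x) \<partial>\<nu>)"
  proof (intro integral_mono int Bochner_Integration.integrable_add Bochner_Integration.integrable_diff 
      integrable_mult_right integrable_H integrable_inner_right Hy)
    fix y
    have "H x y * (f z + g \<bullet> ((z + y - b x) - z)) \<le> H x y * f (z + y - b x)"
      by (intro mult_left_mono g H_nonneg)
    then show "f z * H x y + (g \<bullet> (H x y *\<^sub>R y) - (g \<bullet> b x) * H x y) \<le> H x y * f (z + y - b x)"
      by (simp add: inner_diff_right algebra_simps)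
  qed
  finally show ?thesis .
qed

text \<open>Under the coupling, \<open>z x + y - b x\<close> has conditional mean \<open>z x\<close>. The interesting choices are
  the identity and \<open>z = b\<close>, for which \<open>T\<close> is the second projection.\<close>
lemma cx_le_distr_recentred:
  assumes [measurable]: "z \<in> borel_measurable borel" and z2: "integrable \<mu> (\<lambda>x. norm (z x) ^ 2)"
  defines "T \<equiv> \<lambda>p. z (fst p) + snd p - b (fst p)"
  shows "cx_le (distr \<mu> borel z) (distr \<pi> borel T)" "distr \<pi> borel T \<in> P2"
proof -
  have [measurable]: "T \<in> borel_measurable (borel \<Otimes>\<^sub>M borel)" unfolding T_def by measurable
  have "integrable \<pi> (\<lambda>p. 4 * norm (z (fst p)) ^ 2 + 4 * norm (snd p) ^ 2 + 2 * norm (b (fst p)) ^ 2)"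
    using integrable_fst_snd(1)[OF z2] integrable_fst_snd(2)[OF P2D(4)[OF P2(2)]] integrable_fst_snd(1)[OF integrable_b]
    by simp
  then have T2: "integrable \<pi> (\<lambda>p. norm (T p) ^ 2)"
  proof (rule Bochner_Integration.integrable_bound)
    have "norm (T p) ^ 2 \<le> 4 * norm (z (fst p)) ^ 2 + 4 * norm (snd p) ^ 2 + 2 * norm (b (fst p)) ^ 2" for p
      unfolding T_def using norm_diff_square_le[of "z (fst p) + snd p" "b (fst p)"] norm_add_square_le[of "z (fst p)" "snd p"]
      by linarith
    then show "AE p in \<pi>. norm (norm (T p) ^ 2) \<le> norm (4 * norm (z (fst p)) ^ 2 + 4 * norm (snd p) ^ 2 + 2 * norm (b (fst p)) ^ 2)"
      by (intro AE_I2) (simp add: order_trans[OF _ abs_ge_self])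
  qed simp
  then show "distr \<pi> borel T \<in> P2" by (intro P2_distr prob_space_\<pi>) auto
  show "cx_le (distr \<mu> borel z) (distr \<pi> borel T)"
    unfolding cx_le_def
  proof (intro allI impI)
    fix f :: "'a \<Rightarrow> real" assume f: "convex_on UNIV f"
    note [measurable] = borel_measurable_convex[OF f]
    obtain C where C: "0 \<le> C" "\<And>x. - (C * (1 + norm x ^ 2)) \<le> f x"
      using convex_on_lower_bound[OF f] by blast
    define B where "B = (\<lambda>p. C * (1 + norm (T p) ^ 2))"
    interpret \<pi>: prob_space \<pi> by (rule prob_space_\<pi>)
    have B: "integrable \<pi> B" "\<And>p. 0 \<le> B p" unfolding B_def using T2 C(1) by auto
    have fm: "(\<lambda>p. ereal (f (T p))) \<in> borel_measurable \<pi>" by measurable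
    have fB: "ereal (- B p) \<le> ereal (f (T p))" for p using C(2)[of "T p"] by (simp add: B_def)
    note * = eint_lower_bounded[OF B fm fB]
    have "eint \<mu> (\<lambda>x. ereal (f (z x))) \<le> eint \<pi> (\<lambda>p. ereal (f (T p)))"
    proof (cases "eint \<pi> (\<lambda>p. ereal (f (T p))) = \<infinity>")
      case False
      then have int: "integrable \<pi> (\<lambda>p. f (T p))" using *(4) by simp
      then have int': "integrable (\<mu> \<Otimes>\<^sub>M \<nu>) (\<lambda>p. case_prod H p * f (T p))"
        and eq: "integral\<^sup>L \<pi> (\<lambda>p. f (T p)) = (\<integral>p. case_prod H p * f (T p) \<partial>(\<mu> \<Otimes>\<^sub>M \<nu>))"
        unfolding \<pi>_def using H_nonneg by (auto simp: integrable_density integral_density split_beta)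
      have "AE x in \<mu>. integrable \<nu> (\<lambda>y. H x y * f (z x + y - b x))"
        using AE_integrable_fst'[OF int'] by (simp add: T_def)
      then have "AE x in \<mu>. f (z x) \<le> (\<integral>y. H x y * f (z x + y - b x) \<partial>\<nu>)"
        by eventually_elim (rule jensen_kernel[OF f])
      then have "eint \<mu> (\<lambda>x. ereal (f (z x))) \<le> eint \<mu> (\<lambda>x. ereal (\<integral>y. H x y * f (z x + y - b x) \<partial>\<nu>))"
        by (intro eint_mono_AE) auto
      also have "\<dots> = ereal (\<integral>x. (\<integral>y. H x y * f (z x + y - b x) \<partial>\<nu>) \<partial>\<mu>)"
        using integrable_fst'[OF int'] by (intro eint_integrable) (simp add: T_def)
      also have "\<dots> = ereal (integral\<^sup>L \<pi> (\<lambda>p. f (T p)))"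
        unfolding eq using integral_fst'[OF int'] by (simp add: T_def)
      also have "\<dots> = eint \<pi> (\<lambda>p. ereal (f (T p)))" using int by (rule eint_integrable[symmetric])
      finally show ?thesis .
    qed simp
    then show "eint (distr \<mu> borel z) (\<lambda>x. ereal (f x)) \<le> eint (distr \<pi> borel T) (\<lambda>x. ereal (f x))"
      by (simp add: eint_distr)
  qed
qed

lemma nn_integral_cost: 
  "(\<integral>\<^sup>+x. ennreal (norm (x - b x) ^ 2) \<partial>\<mu>) = ennreal (\<integral>x. norm (x - b x) ^ 2 \<partial>\<mu>)"
proof (intro nn_integral_eq_integral)
  have "integrable \<mu> (\<lambda>x. 2 * norm x ^ 2 + 2 * norm (b x) ^ 2)"
    using P2D(4)[OF P2(1)] integrable_b by simp
  then show "integrable \<mu> (\<lambda>x. norm (x - b x) ^ 2)"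
    by (rule Bochner_Integration.integrable_bound) (auto intro!: AE_I2 norm_diff_square_le)
qed simp

text \<open>The competitor is the law of \<open>b\<close>, with \<open>\<mu>\<close> transported
  along the graph of \<open>b\<close>.\<close>

lemma T2_right_le: "T2_right \<mu> \<nu> \<le> ereal (\<integral>x. norm (x - b x) ^ 2 \<partial>\<mu>)"
proof -
  have "cx_le (distr \<mu> borel b) \<nu>"
    using cx_le_distr_recentred(1)[OF b_measurable integrable_b] by (simp add: distr_snd)
  then have "distr \<mu> borel b \<in> P2_cx_le \<nu>"
    unfolding P2_cx_le_def by (auto intro!: P2_distr mu.prob_space_axioms integrable_b)
  then have "T2_right \<mu> \<nu> \<le> T2 \<mu> (distr \<mu> borel b)" unfolding T2_right_def by (rule INF_lower)
  also have "\<dots> = T2 (distr \<mu> borel (\<lambda>x. x)) (distr \<mu> borel b)"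
    using P2D(2)[OF P2(1)] by (simp add: distr_id2)
  also have "\<dots> \<le> enn2ereal (\<integral>\<^sup>+x. ennreal (norm (x - b x) ^ 2) \<partial>\<mu>)"
    by (intro T2_distr_le mu.prob_space_axioms) auto
  finally show ?thesis by (simp add: nn_integral_cost)
qed

text \<open>The competitor is the law of \<open>x + y - b x\<close>, coupled with
  \<open>\<nu>\<close> through the second coordinate. The difference of the two is
  \<open>x - b x\<close>, free of \<open>y\<close>.\<close>

lemma T2_left_le: "T2_left \<mu> \<nu> \<le> ereal (\<integral>x. norm (x - b x) ^ 2 \<partial>\<mu>)"
proof -
  let ?T = "\<lambda>p. fst p + snd p - b (fst p)"
  have "cx_le (distr \<mu> borel (\<lambda>x. x)) (distr \<pi> borel ?T)" "distr \<pi> borel ?T \<in> P2"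
    using cx_le_distr_recentred[of "\<lambda>x. x"] P2D(4)[OF P2(1)] by auto
  then have "distr \<pi> borel ?T \<in> P2_cx_ge \<mu>"
    unfolding P2_cx_ge_def using P2D(2)[OF P2(1)] by (simp add: distr_id2)
  then have "T2_left \<mu> \<nu> \<le> T2 (distr \<pi> borel ?T) \<nu>" unfolding T2_left_def by (rule INF_lower)
  also have "\<dots> = T2 (distr \<pi> borel ?T) (distr \<pi> borel snd)" by (simp add: distr_snd)
  also have "\<dots> \<le> enn2ereal (\<integral>\<^sup>+p. ennreal (norm (?T p - snd p) ^ 2) \<partial>\<pi>)"
    by (intro T2_distr_le prob_space_\<pi>) auto
  also have "(\<integral>\<^sup>+p. ennreal (norm (?T p - snd p) ^ 2) \<partial>\<pi>) = (\<integral>\<^sup>+p. ennreal (norm (fst p - b (fst p)) ^ 2) \<partial>\<pi>)"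
    by (simp add: algebra_simps)
  also have "\<dots> = (\<integral>\<^sup>+x. ennreal (norm (x - b x) ^ 2) \<partial>distr \<pi> borel fst)"
    by (subst nn_integral_distr) auto
  finally show ?thesis by (simp add: distr_fst nn_integral_cost)
qed

end

section \<open>Strong duality\<close>

lemma exists_fine_finite_partition:
  fixes \<nu> :: "'a::euclidean_space measure"
  assumes P2: "\<nu> \<in> P2" and e: "0 < e"
  obtains s :: "'a \<Rightarrow> 'a" and I where
    "s \<in> borel_measurable borel" "finite I" "\<And>y. s y \<in> I" "\<And>i. i \<in> I \<Longrightarrow> 0 < measure \<nu> (s -` {i})"
    "(\<integral>y. norm (y - s y) ^ 2 \<partial>\<nu>) < e"
proof -
  interpret prob_space \<nu> using P2D(1)[OF P2] .
  note [measurable_cong] = P2D(2)[OF P2] and sp = P2D(3)[OF P2]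
  obtain F :: "nat \<Rightarrow> 'a \<Rightarrow> 'a" where F: "\<And>n. simple_function borel (F n)" "\<And>x. (\<lambda>n. F n x) \<longlonglongrightarrow> x"
      "\<And>n x. norm (F n x) \<le> 2 * norm x"
    using borel_measurable_implies_sequence_metric[of "\<lambda>x::'a. x" borel 0] by auto
  have Fm[measurable]: "F n \<in> borel_measurable borel" for n
    using F(1) by (rule borel_measurable_simple_function)
  have "(\<lambda>n. \<integral>y. norm (y - F n y) ^ 2 \<partial>\<nu>) \<longlonglongrightarrow> (\<integral>y. 0 \<partial>\<nu>)"
  \<comment> \<open>The constant is \<open>2 + 2 * 2^2\<close>, as the approximations satisfy
    \<open>norm (F n y) \<le> 2 * norm y\<close>.\<close>
  proof (rule integral_dominated_convergence[where w = "\<lambda>y. 10 * norm y ^ 2"])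
    show "AE y in \<nu>. (\<lambda>n. norm (y - F n y) ^ 2) \<longlonglongrightarrow> 0"
    proof (intro AE_I2)
      fix y
      have "(\<lambda>n. norm (y - F n y) ^ 2) \<longlonglongrightarrow> norm (y - y) ^ 2" by (intro tendsto_intros F)
      then show "(\<lambda>n. norm (y - F n y) ^ 2) \<longlonglongrightarrow> 0" by simp
    qed
    show "AE y in \<nu>. norm (norm (y - F n y) ^ 2) \<le> 10 * norm y ^ 2" for n
    proof (intro AE_I2)
      fix y
      have "norm (F n y) ^ 2 \<le> (2 * norm y) ^ 2" by (intro power_mono F) auto
      then show "norm (norm (y - F n y) ^ 2) \<le> 10 * norm y ^ 2"
        using norm_diff_square_le[of y "F n y"] by (simp add: power_mult_distrib)
    qed
  qed (use P2D(4)[OF P2] in auto)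
  then have "\<forall>\<^sub>F n in sequentially. (\<integral>y. norm (y - F n y) ^ 2 \<partial>\<nu>) < e"
    using e by (intro order_tendstoD(2)) auto
  then obtain n where n: "(\<integral>y. norm (y - F n y) ^ 2 \<partial>\<nu>) < e"
    by (auto simp: eventually_sequentially)
  define J where "J = range (F n)"
  have J: "finite J" using F(1)[of n] by (simp add: J_def simple_function_def)
  define I where "I = {i \<in> J. 0 < measure \<nu> (F n -` {i})}"
  have "AE y in \<nu>. \<forall>i\<in>J - I. F n y \<noteq> i"
  proof (intro AE_finite_allI)
    fix i assume "i \<in> J - I"
    then have "measure \<nu> (F n -` {i}) = 0" 
      using measure_nonneg[of \<nu> "F n -` {i}"] by (auto simp: I_def simp del: measure_nonneg)
    then have "emeasure \<nu> (F n -` {i}) = 0" by (simp add: emeasure_eq_measure)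
    moreover have "F n -` {i} \<in> sets \<nu>"
      using measurable_sets[OF Fm, of "{i}" n] P2D(2)[OF P2] by simp
    ultimately show "AE y in \<nu>. F n y \<noteq> i" by (intro AE_I[of _ _ "F n -` {i}"]) (auto simp: sp)
  qed (use J in auto)
  then have AE: "AE y in \<nu>. F n y \<in> I"
    by eventually_elim (auto simp: J_def)
  have "I \<noteq> {}" using AE by (auto simp: AE_False)
  then obtain i0 where i0: "i0 \<in> I" by auto
  \<comment> \<open>Values taken with probability zero are redirected to \<open>i0\<close>: the
    masses of the cells become denominators and must be positive, while \<open>s\<close> has to land
    in \<open>I\<close> everywhere and not just almost everywhere.\<close>
  define s where "s = (\<lambda>y. if F n y \<in> I then F n y else i0)"
  have fI: "finite I" using J by (auto simp: I_def)
  have [measurable]: "I \<in> sets borel" using fI by (simp add: finite_imp_closed)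
  have s[measurable]: "s \<in> borel_measurable borel" unfolding s_def by measurable
  have AE': "AE y in \<nu>. s y = F n y" using AE by eventually_elim (simp add: s_def)
  show thesis
  proof (rule that[OF s fI])
    show "s y \<in> I" for y using i0 by (simp add: s_def)
    show "0 < measure \<nu> (s -` {i})" if i: "i \<in> I" for i
    proof -
      have "measure \<nu> (s -` {i}) = measure \<nu> (F n -` {i})"
        using AE' measurable_sets[OF Fm, of "{i}" n] measurable_sets[OF s, of "{i}"] P2D(2)[OF P2]
        by (intro finite_measure_eq_AE) (auto elim!: eventually_mono)
      then show ?thesis using i by (simp add: I_def)
    qed
    have "(\<integral>y. norm (y - s y) ^ 2 \<partial>\<nu>) = (\<integral>y. norm (y - F n y) ^ 2 \<partial>\<nu>)"
      using AE' by (intro integral_cong_AE) (auto elim!: eventually_mono)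
    then show "(\<integral>y. norm (y - s y) ^ 2 \<partial>\<nu>) < e" using n by simp
  qed
qed

section \<open>Cells of a finite partition and their means\<close>

locale finite_partition =
  fixes \<nu> :: "'a::euclidean_space measure" and s :: "'a \<Rightarrow> 'a" and I :: "'a set"
  assumes P2_nu: "\<nu> \<in> P2" and s_measurable: "s \<in> borel_measurable borel" and finite_I: "finite I"
    and s_in: "\<And>y. s y \<in> I" and cell_pos: "\<And>i. i \<in> I \<Longrightarrow> 0 < measure \<nu> (s -` {i})"
begin

sublocale prob_space \<nu> using P2D(1)[OF P2_nu] .

declare P2D(2)[OF P2_nu, measurable_cong] s_measurable[measurable]

abbreviation cell :: "'a \<Rightarrow> 'a \<Rightarrow> real" where
  "cell i \<equiv> indicator (s -` {i})"

definition p :: "'a \<Rightarrow> real" where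
  "p i = measure \<nu> (s -` {i})"

text \<open>Mean of \<open>\<nu>\<close> conditioned on the cell. The means, not the values of
  \<open>s\<close>, serve as targets: spreading a weight over a cell in proportion to
  \<open>\<nu>\<close> then reproduces the barycentre exactly.\<close>

definition m :: "'a \<Rightarrow> 'a" where
  "m i = (1 / p i) *\<^sub>R (\<integral>y. cell i y *\<^sub>R y \<partial>\<nu>)"

lemma p_pos: "i \<in> I \<Longrightarrow> 0 < p i"
  unfolding p_def by (rule cell_pos)

lemma cell_sets[measurable]: "s -` {i} \<in> sets borel"
  using measurable_sets[OF s_measurable, of "{i}"] by simp

lemma sum_cell:
  fixes f :: "'a \<Rightarrow> 'b::real_vector"
  shows "(\<Sum>i\<in>I. cell i y *\<^sub>R f i) = f (s y)"
proof -
  have "(\<Sum>i\<in>I. cell i y *\<^sub>R f i) = (\<Sum>i\<in>I. if i = s y then f i else 0)"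
    by (intro sum.cong) (auto simp: indicator_def)
  then show ?thesis using finite_I s_in by simp
qed

lemma integrable_cell: "integrable \<nu> (cell i)" 
  by (intro integrable_const_bound[of _ 1]) (auto simp: indicator_def)

lemma integral_cell: "(\<integral>y. cell i y \<partial>\<nu>) = p i"
  using P2D(2)[OF P2_nu] P2D(3)[OF P2_nu] by (simp add: p_def)

lemma integrable_id: "integrable \<nu> (\<lambda>y. y)"
  by (intro P2_integrable_quadratic[OF P2_nu, of _ 1]) (auto simp: norm_le_one_plus_square)

lemma integrable_cell_id: "integrable \<nu> (\<lambda>y. cell i y *\<^sub>R y)"
  by (rule Bochner_Integration.integrable_bound[OF integrable_id]) (auto simp: indicator_def)

lemma integral_cell_id: "i \<in> I \<Longrightarrow> (\<integral>y. cell i y *\<^sub>R y \<partial>\<nu>) = p i *\<^sub>R m i"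
  using p_pos[of i] by (simp add: m_def)

lemma integrable_simple: "integrable \<nu> (\<lambda>y. f (s y))"
  and integral_simple: "(\<integral>y. f (s y) \<partial>\<nu>) = (\<Sum>i\<in>I. p i * f i)" for f :: "'a \<Rightarrow> real"
proof -
  have *: "(\<lambda>y. f (s y)) = (\<lambda>y. \<Sum>i\<in>I. cell i y * f i)" using sum_cell[of _ f] by auto
  show "integrable \<nu> (\<lambda>y. f (s y))" unfolding *
    by (intro Bochner_Integration.integrable_sum integrable_mult_left integrable_cell)
  show "(\<integral>y. f (s y) \<partial>\<nu>) = (\<Sum>i\<in>I. p i * f i)" unfolding *
    by (simp add: Bochner_Integration.integral_sum integrable_cell integral_cell del: Bochner_Integration.integral_indicator)
qed

lemma sum_p: "sum p I = 1"
  using integral_simple[of "\<lambda>_. 1"] by (simp add: prob_space)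

lemma measurable_simple[measurable]:
  fixes f :: "'a \<Rightarrow> 'b::euclidean_space"
  shows "(\<lambda>y. f (s y)) \<in> borel_measurable borel"
proof -
  have *: "(\<lambda>y. f (s y)) = (\<lambda>y. \<Sum>i\<in>I. cell i y *\<^sub>R f i)" using sum_cell[of _ f] by auto
  show ?thesis unfolding * by measurable
qed

lemma integrable_square_diff_simple:
  fixes f :: "'a \<Rightarrow> 'a"
  shows "integrable \<nu> (\<lambda>y. norm (y - f (s y)) ^ 2)"
proof (rule P2_integrable_quadratic[OF P2_nu, of _ "2 + 2 * (\<Sum>i\<in>I. norm (f i) ^ 2)"])
  fix y
  have 1: "norm (f (s y)) ^ 2 \<le> (\<Sum>i\<in>I. norm (f i) ^ 2)"
    using member_le_sum[of "s y" I "\<lambda>i. norm (f i) ^ 2"] s_in finite_I by simp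
  have "0 \<le> (\<Sum>i\<in>I. norm (f i) ^ 2) * norm y ^ 2" by (intro mult_nonneg_nonneg sum_nonneg) auto
  then show "norm (norm (y - f (s y)) ^ 2) \<le> (2 + 2 * (\<Sum>i\<in>I. norm (f i) ^ 2)) * (1 + norm y ^ 2)"
    using 1 norm_diff_square_le[of y "f (s y)"] by (simp add: algebra_simps)
qed measurable

text \<open>Within each cell the mean is the best constant approximation in mean square.\<close>

lemma variance_le: "(\<integral>y. norm (y - m (s y)) ^ 2 \<partial>\<nu>) \<le> (\<integral>y. norm (y - s y) ^ 2 \<partial>\<nu>)"
proof -
  \<comment> \<open>Cross term in the expansion of \<open>|y - s y|^2\<close> about
    \<open>m (s y)\<close>, written cell by cell because each summand integrates to zero by the
    definition of the mean.\<close>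
  define h where "h = (\<lambda>y. \<Sum>i\<in>I. (cell i y *\<^sub>R y - cell i y *\<^sub>R m i) \<bullet> (m i - i))"
  have h_eq: "h y = (y - m (s y)) \<bullet> (m (s y) - s y)" for y
    unfolding h_def using sum_cell[where f = "\<lambda>i. (y - m i) \<bullet> (m i - i)" and y = y]
    by (simp add: scaleR_diff_right[symmetric])
  have int: "integrable \<nu> (\<lambda>y. (cell i y *\<^sub>R y - cell i y *\<^sub>R m i) \<bullet> (m i - i))" for i
    by (intro integrable_inner_left Bochner_Integration.integrable_diff integrable_cell_id integrable_scaleR_left integrable_cell)
  have "(\<integral>y. h y \<partial>\<nu>) = (\<Sum>i\<in>I. (\<integral>y. (cell i y *\<^sub>R y - cell i y *\<^sub>R m i) \<bullet> (m i - i) \<partial>\<nu>))"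
    unfolding h_def by (intro Bochner_Integration.integral_sum int)
  also have "\<dots> = (\<Sum>i\<in>I. 0)"
  proof (intro sum.cong refl)
    fix i assume i: "i \<in> I"
    have d: "integrable \<nu> (\<lambda>y. cell i y *\<^sub>R y - cell i y *\<^sub>R m i)"
      by (intro Bochner_Integration.integrable_diff integrable_cell_id integrable_scaleR_left integrable_cell)
    have "(\<integral>y. (cell i y *\<^sub>R y - cell i y *\<^sub>R m i) \<bullet> (m i - i) \<partial>\<nu>)
        = (\<integral>y. cell i y *\<^sub>R y - cell i y *\<^sub>R m i \<partial>\<nu>) \<bullet> (m i - i)"
      using d by simp
    also have "(\<integral>y. cell i y *\<^sub>R y - cell i y *\<^sub>R m i \<partial>\<nu>) = p i *\<^sub>R m i - p i *\<^sub>R m i"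
      using integrable_cell_id[of i] integrable_cell[of i] integral_cell_id[OF i] integral_cell[of i]
      by (simp del: Bochner_Integration.integral_indicator)
    finally show "(\<integral>y. (cell i y *\<^sub>R y - cell i y *\<^sub>R m i) \<bullet> (m i - i) \<partial>\<nu>) = 0" by simp
  qed
  finally have h0: "(\<integral>y. h y \<partial>\<nu>) = 0" by simp
  have hi: "integrable \<nu> h" unfolding h_def by (intro Bochner_Integration.integrable_sum int)
  have "(\<integral>y. norm (y - m (s y)) ^ 2 \<partial>\<nu>) = (\<integral>y. norm (y - m (s y)) ^ 2 + 2 * h y \<partial>\<nu>)"
    using integrable_square_diff_simple[of m] hi h0 by simp
  also have "\<dots> \<le> (\<integral>y. norm (y - s y) ^ 2 \<partial>\<nu>)"
  proof (intro integral_mono Bochner_Integration.integrable_add integrable_square_diff_simple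
      integrable_square_diff_simple[of "\<lambda>i. i"] integrable_mult_right hi)
    fix y
    have "norm (y - s y) ^ 2 = norm (y - m (s y)) ^ 2 + 2 * ((y - m (s y)) \<bullet> (m (s y) - s y)) + norm (m (s y) - s y) ^ 2"
      unfolding power2_norm_eq_inner by (simp add: inner_simps inner_commute algebra_simps)
    then show "norm (y - m (s y)) ^ 2 + 2 * h y \<le> norm (y - s y) ^ 2" unfolding h_eq by simp
  qed
  finally show ?thesis .
qed

end

text \<open>\<open>u + v\<close> is the convex combination with weights \<open>a\<close> and \<open>1 - a\<close> of \<open>u / a\<close> and \<open>v / (1 - a)\<close>.\<close>
lemma scaled_norm_square_le:
  fixes u v :: "'a::real_inner"
  assumes a: "0 < a" "a < 1"
  shows "a * norm (u + v) ^ 2 \<le> norm u ^ 2 + a / (1 - a) * norm v ^ 2"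
proof -
  have "u + v = (1 - a) *\<^sub>R ((1 / (1 - a)) *\<^sub>R v) + a *\<^sub>R ((1 / a) *\<^sub>R u)" using a by simp
  then have "norm (u + v) ^ 2 \<le> (1 - a) * norm ((1 / (1 - a)) *\<^sub>R v) ^ 2 + a * norm ((1 / a) *\<^sub>R u) ^ 2"
    using a norm_convex_comb_square_le[of a] by (metis less_imp_le)
  also have "\<dots> = norm v ^ 2 / (1 - a) + norm u ^ 2 / a"
    using a by (simp add: power_divide power2_eq_square)
  finally have "a * norm (u + v) ^ 2 \<le> a * (norm v ^ 2 / (1 - a) + norm u ^ 2 / a)"
    using a by (intro mult_left_mono) auto
  then show ?thesis using a by (simp add: distrib_left add.commute)
qed

text \<open>\<open>J\<close> is the barycentric cost of one explicit coupling. The loss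
  \<open>a * \<epsilon>\<close> stems from the regularization, and
  \<open>a / (1 - a) * \<delta>\<close> from the distance between points and the means of their
  cells.\<close>

lemma primal_le_dual_approx:
  fixes \<mu> \<nu> :: "'a::euclidean_space measure"
  assumes P2: "\<mu> \<in> P2" "\<nu> \<in> P2" and a: "0 < a" "a < 1" and e: "0 < \<epsilon>" "0 < \<delta>"
  obtains J where "T2_left \<mu> \<nu> \<le> ereal J" "T2_right \<mu> \<nu> \<le> ereal J"
    "ereal (a * J - a * \<epsilon> - a / (1 - a) * \<delta>) \<le> D2_left \<mu> \<nu>"
proof -
  obtain s I where sI: "s \<in> borel_measurable borel" "finite I" "\<And>y::'a. s y \<in> I"
      "\<And>i. i \<in> I \<Longrightarrow> 0 < measure \<nu> (s -` {i})" and \<delta>: "(\<integral>y. norm (y - s y) ^ 2 \<partial>\<nu>) < \<delta>"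
    by (rule exists_fine_finite_partition[OF P2(2) e(2)]) blast
  interpret finite_partition \<nu> s I using sI P2(2) by unfold_locales
  interpret mu: prob_space \<mu> using P2D(1)[OF P2(1)] .
  obtain w q \<phi> C where w: "\<And>i. continuous_on UNIV (\<lambda>x. w x i)" "\<And>x i. 0 \<le> w x i" "\<And>x. (\<Sum>i\<in>I. w x i) = 1"
      "\<And>i. i \<in> I \<Longrightarrow> (\<integral>x. w x i \<partial>\<mu>) = p i"
    and q: "convex_on UNIV q" "0 \<le> C" "\<And>x. \<bar>q x\<bar> \<le> C * (1 + norm x ^ 2)"
      "\<And>x i. i \<in> I \<Longrightarrow> q x \<le> norm (x - m i) ^ 2 + \<epsilon> + \<phi> i"
    and cost: "(\<integral>x. norm (x - (\<Sum>i\<in>I. w x i *\<^sub>R m i)) ^ 2 \<partial>\<mu>) \<le> integral\<^sup>L \<mu> q - (\<Sum>i\<in>I. \<phi> i * p i)"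
    by (rule barycentric_duality[OF P2(1) finite_I p_pos sum_p e(1), of m]) (assumption, (rule that; assumption))
  define b where "b = (\<lambda>x. \<Sum>i\<in>I. w x i *\<^sub>R m i)"
  \<comment> \<open>Given \<open>x\<close>, a cell \<open>i\<close> is drawn with probability
    \<open>w x i\<close> and then a point from \<open>\<nu>\<close> conditioned on that cell. The
    mean constraints on \<open>w\<close> make the second marginal equal to
    \<open>\<nu>\<close>.\<close>
  define H where "H = (\<lambda>x y. \<Sum>i\<in>I. cell i y * (w x i / p i))"
  have H_eq: "H x y = w x (s y) / p (s y)" for x y
    unfolding H_def using sum_cell[of y "\<lambda>i. w x i / p i"] by simp
  have w_le: "w x i \<le> 1" if "i \<in> I" for x i
    using w(3)[of x] w(2) member_le_sum[of i I "w x"] finite_I that by simp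
  have [measurable]: "(\<lambda>x. w x i) \<in> borel_measurable borel" for i
    by (intro borel_measurable_continuous_onI w)
  note [measurable_cong] = P2D(2)[OF P2(1)]
  have wm: "integrable \<mu> (\<lambda>x. w x i)" if "i \<in> I" for i
    using that w(2) w_le by (intro mu.integrable_const_bound[of _ 1]) auto
  interpret C: density_coupling \<mu> \<nu> H b "\<Sum>i\<in>I. 1 / p i" "\<Sum>i\<in>I. norm (m i)"
  proof
    show "case_prod H \<in> borel_measurable (borel \<Otimes>\<^sub>M borel)"
      unfolding H_def by measurable
    show "0 \<le> H x y" for x y
      unfolding H_eq using w(2) p_pos[OF s_in, of y] by (auto intro!: divide_nonneg_pos)
    show "H x y \<le> (\<Sum>i\<in>I. 1 / p i)" for x y
    proof -
      have "H x y \<le> 1 / p (s y)"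
        unfolding H_eq using w_le[OF s_in] p_pos[OF s_in, of y] by (intro divide_right_mono) auto
      also have "\<dots> \<le> (\<Sum>i\<in>I. 1 / p i)"
        using s_in finite_I p_pos by (intro member_le_sum) (auto intro: less_imp_le)
      finally show ?thesis .
    qed
    show "(\<integral>y. H x y \<partial>\<nu>) = 1" for x
    proof -
      have "(\<integral>y. H x y \<partial>\<nu>) = (\<Sum>i\<in>I. p i * (w x i / p i))"
        unfolding H_eq by (rule integral_simple)
      also have "\<dots> = (\<Sum>i\<in>I. w x i)" using p_pos by (intro sum.cong) (auto simp: less_imp_neq[symmetric])
      finally show ?thesis by (simp add: w)
    qed
    show "(\<integral>x. H x y \<partial>\<mu>) = 1" for y
      unfolding H_eq using w(4)[OF s_in, of y] p_pos[OF s_in, of y] by simp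
    show "b \<in> borel_measurable borel" unfolding b_def by measurable
    show "norm (b x) \<le> (\<Sum>i\<in>I. norm (m i))" for x
      unfolding b_def using w(2) w_le by (intro sum_norm_le) (auto intro!: mult_left_le_one_le)
    show "(\<integral>y. H x y *\<^sub>R y \<partial>\<nu>) = b x" for x
    proof -
      have "(\<integral>y. H x y *\<^sub>R y \<partial>\<nu>) = (\<integral>y. (\<Sum>i\<in>I. (w x i / p i) *\<^sub>R (cell i y *\<^sub>R y)) \<partial>\<nu>)"
        unfolding H_def by (simp add: scaleR_sum_left mult.commute)
      also have "\<dots> = (\<Sum>i\<in>I. (w x i / p i) *\<^sub>R (\<integral>y. cell i y *\<^sub>R y \<partial>\<nu>))"
        by (simp add: Bochner_Integration.integral_sum integrable_cell_id del: scaleR_scaleR)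
      also have "\<dots> = b x"
        unfolding b_def using p_pos by (intro sum.cong) (auto simp: integral_cell_id less_imp_neq[symmetric])
      finally show ?thesis .
    qed
  qed (use P2 in auto)
  define J where "J = (\<integral>x. norm (x - b x) ^ 2 \<partial>\<mu>)"
  define f where "f = (\<lambda>x. a * q x)"
  have f: "convex_on UNIV f" "\<And>x. \<bar>f x\<bar> \<le> C * (1 + norm x ^ 2)"
  proof -
    show "convex_on UNIV f" unfolding f_def using a q(1) by (intro convex_on_cmul) auto
    fix x
    have "\<bar>f x\<bar> = a * \<bar>q x\<bar>" using a by (simp add: f_def abs_mult)
    also have "\<dots> \<le> \<bar>q x\<bar>" using a by (intro mult_left_le_one_le) auto
    finally show "\<bar>f x\<bar> \<le> C * (1 + norm x ^ 2)" using q(3)[of x] by simp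
  qed
  \<comment> \<open>For each \<open>y\<close> the bound on \<open>q\<close> is used at the index
    \<open>s y\<close> alone. Splitting \<open>x - m (s y)\<close> at \<open>y\<close> lets the
    square of \<open>x - y\<close> cancel against the cost, which leaves a bound independent of
    \<open>x\<close>.\<close>
  have "Qbar2 (\<lambda>x. ereal (f x)) y \<le> ereal (a * (\<epsilon> + \<phi> (s y)) + a / (1 - a) * norm (y - m (s y)) ^ 2)" for y
    unfolding Qbar2_def
  proof (intro SUP_least)
    fix x
    have "f x \<le> a * (norm (x - m (s y)) ^ 2 + \<epsilon> + \<phi> (s y))"
      unfolding f_def using a by (intro mult_left_mono q s_in) auto
    moreover have "a * norm ((x - y) + (y - m (s y))) ^ 2 \<le> norm (x - y) ^ 2 + a / (1 - a) * norm (y - m (s y)) ^ 2"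
      by (intro scaled_norm_square_le a)
    ultimately have "f x - norm (x - y) ^ 2 \<le> a * (\<epsilon> + \<phi> (s y)) + a / (1 - a) * norm (y - m (s y)) ^ 2"
      by (simp add: algebra_simps)
    then show "ereal (f x) - ereal (norm (x - y) ^ 2) \<le> ereal (a * (\<epsilon> + \<phi> (s y)) + a / (1 - a) * norm (y - m (s y)) ^ 2)"
      by simp
  qed
  then have "eint \<nu> (Qbar2 (\<lambda>x. ereal (f x))) \<le> eint \<nu> (\<lambda>y. ereal (a * (\<epsilon> + \<phi> (s y)) + a / (1 - a) * norm (y - m (s y)) ^ 2))"
    by (rule eint_mono)
  also have "\<dots> = ereal (\<integral>y. a * (\<epsilon> + \<phi> (s y)) + a / (1 - a) * norm (y - m (s y)) ^ 2 \<partial>\<nu>)"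
    by (intro eint_integrable Bochner_Integration.integrable_add integrable_mult_right integrable_simple
        integrable_square_diff_simple)
  also have "(\<integral>y. a * (\<epsilon> + \<phi> (s y)) + a / (1 - a) * norm (y - m (s y)) ^ 2 \<partial>\<nu>)
      = a * (\<epsilon> + (\<Sum>i\<in>I. \<phi> i * p i)) + a / (1 - a) * (\<integral>y. norm (y - m (s y)) ^ 2 \<partial>\<nu>)"
    using integrable_simple[of \<phi>] integral_simple[of \<phi>] integrable_square_diff_simple[of m]
    by (simp add: prob_space mult.commute)
  finally have Q: "eint \<nu> (Qbar2 (\<lambda>x. ereal (f x)))
      \<le> ereal (a * (\<epsilon> + (\<Sum>i\<in>I. \<phi> i * p i)) + a / (1 - a) * (\<integral>y. norm (y - m (s y)) ^ 2 \<partial>\<nu>))" .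
  have "ereal (a * J - a * \<epsilon> - a / (1 - a) * \<delta>) \<le> ereal (a * integral\<^sup>L \<mu> q) -
      ereal (a * (\<epsilon> + (\<Sum>i\<in>I. \<phi> i * p i)) + a / (1 - a) * (\<integral>y. norm (y - m (s y)) ^ 2 \<partial>\<nu>))"
  proof -
    have "a * J \<le> a * (integral\<^sup>L \<mu> q - (\<Sum>i\<in>I. \<phi> i * p i))"
      using cost a by (intro mult_left_mono) (auto simp: J_def b_def)
    moreover have "a / (1 - a) * (\<integral>y. norm (y - m (s y)) ^ 2 \<partial>\<nu>) \<le> a / (1 - a) * \<delta>"
      using variance_le \<delta> a by (intro mult_left_mono) auto
    ultimately show ?thesis by (simp add: algebra_simps)
  qed
  also have "\<dots> \<le> eint \<mu> (\<lambda>x. ereal (f x)) - eint \<nu> (Qbar2 (\<lambda>x. ereal (f x)))"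
    using Q P2_integrable_convex[OF P2(1) f]
    by (intro ereal_minus_mono) (auto simp: eint_integrable f_def)
  also have "\<dots> \<le> D2_left \<mu> \<nu>"
    using f by (intro D2_left_upper) (auto simp: Acx_ereal intro!: Sb2_ereal borel_measurable_convex)
  finally have D: "ereal (a * J - a * \<epsilon> - a / (1 - a) * \<delta>) \<le> D2_left \<mu> \<nu>" .
  show thesis
    using C.T2_left_le C.T2_right_le D by (intro that[of J]) (auto simp: J_def)
qed

lemma primal_le_dual:
  fixes \<mu> \<nu> :: "'a::euclidean_space measure"
  assumes P2: "\<mu> \<in> P2" "\<nu> \<in> P2"
  shows "T2_left \<mu> \<nu> \<le> D2_left \<mu> \<nu>" "T2_right \<mu> \<nu> \<le> D2_left \<mu> \<nu>"
proof -
  have "T2_left \<mu> \<nu> \<le> D2_left \<mu> \<nu> \<and> T2_right \<mu> \<nu> \<le> D2_left \<mu> \<nu>"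
  proof (cases "D2_left \<mu> \<nu>")
    case (real d)
    have d: "0 \<le> d" using D2_left_nonneg[of \<mu> \<nu>] real by simp
    have main: "T2_left \<mu> \<nu> \<le> ereal d + ereal e \<and> T2_right \<mu> \<nu> \<le> ereal d + ereal e" if e: "0 < e" for e
    proof -
      \<comment> \<open>This choice gives \<open>d \<le> a * (d + e / 3)\<close>, and the summand
        \<open>e / 6\<close> keeps \<open>a\<close> positive when \<open>d = 0\<close>. The
        tolerance \<open>(1 - a) * (e / 3)\<close> below cancels the factor
        \<open>1 / (1 - a)\<close>, so that three errors of \<open>a * (e / 3)\<close> add up to
        \<open>a * e\<close>.\<close>
      define a where "a = (d + e / 6) / (d + e / 3)"
      have a: "0 < a" "a < 1" using d e by (auto simp: a_def field_simps)
      obtain J where J: "T2_left \<mu> \<nu> \<le> ereal J" "T2_right \<mu> \<nu> \<le> ereal J"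
          "ereal (a * J - a * (e / 3) - a / (1 - a) * ((1 - a) * (e / 3))) \<le> D2_left \<mu> \<nu>"
        using primal_le_dual_approx[OF P2 a, of "e / 3" "(1 - a) * (e / 3)"] a e by auto
      have "a * J - a * (e / 3) - a * (e / 3) \<le> d" using J(3) a by (simp add: real)
      also have "d \<le> a * (d + e / 3)" using d e by (simp add: a_def)
      finally have "a * J \<le> a * (d + e)" by (simp add: algebra_simps)
      then have "J \<le> d + e" using a by simp
      then have "ereal J \<le> ereal d + ereal e" by simp
      then show ?thesis using J by (meson order_trans)
    qed
    have "T2_left \<mu> \<nu> \<le> ereal d" by (rule ereal_le_epsilon2) (use main in blast)
    moreover have "T2_right \<mu> \<nu> \<le> ereal d" by (rule ereal_le_epsilon2) (use main in blast)
    ultimately show ?thesis by (simp add: real)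
  qed (use D2_left_nonneg[of \<mu> \<nu>] in auto)
  then show "T2_left \<mu> \<nu> \<le> D2_left \<mu> \<nu>" "T2_right \<mu> \<nu> \<le> D2_left \<mu> \<nu>" by auto
qed

theorem mainTheorem13:
  fixes \<mu> \<nu> :: "'a::euclidean_space measure"
  assumes "\<mu> \<in> P2" and "\<nu> \<in> P2"
  shows "T2_left \<mu> \<nu> = D2_left \<mu> \<nu> \<and> D2_left \<mu> \<nu> = D2_right \<mu> \<nu> \<and>
         D2_right \<mu> \<nu> = T2_right \<mu> \<nu> \<and>
         (\<forall>\<phi>f. Acx \<phi>f \<and> Cb2 \<phi>f \<and> eint \<mu> \<phi>f - eint \<nu> (Qbar2 \<phi>f) = D2_left \<mu> \<nu> \<longrightarrow>
            Acx (Qbar2 \<phi>f) \<and> L1 \<nu> (Qbar2 \<phi>f) \<and>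
            eint \<mu> (Q2 (Qbar2 \<phi>f)) - eint \<nu> (Qbar2 \<phi>f) = D2_right \<mu> \<nu>) \<and>
         (\<forall>\<phi>b. Acx \<phi>b \<and> L1 \<nu> \<phi>b \<and> eint \<mu> (Q2 \<phi>b) - eint \<nu> \<phi>b = D2_right \<mu> \<nu> \<longrightarrow>
            Acx (Q2 \<phi>b) \<and> Sb2 (Q2 \<phi>b) \<and>
            eint \<mu> (Q2 \<phi>b) - eint \<nu> (Qbar2 (Q2 \<phi>b)) = D2_left \<mu> \<nu>)"
proof (intro conjI allI impI)
  show "T2_left \<mu> \<nu> = D2_left \<mu> \<nu>"
    by (intro antisym primal_le_dual D2_left_le_T2_left assms)
  show eq: "D2_left \<mu> \<nu> = D2_right \<mu> \<nu>"
    by (intro D2_left_eq_D2_right assms)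
  show "D2_right \<mu> \<nu> = T2_right \<mu> \<nu>"
    unfolding eq[symmetric] by (intro antisym primal_le_dual D2_left_le_T2_right assms)
  fix \<phi>
  {
    assume *: "Acx \<phi> \<and> Cb2 \<phi> \<and> eint \<mu> \<phi> - eint \<nu> (Qbar2 \<phi>) = D2_left \<mu> \<nu>"
    then have "Sb2 \<phi>" unfolding Cb2_def Sb2_def by (auto intro: borel_measurable_continuous_onI)
    moreover have "eint \<mu> \<phi> - eint \<nu> (Qbar2 \<phi>) \<noteq> -\<infinity>"
      using * D2_left_nonneg[of \<mu> \<nu>] by auto
    ultimately show Q: "Acx (Qbar2 \<phi>)" "L1 \<nu> (Qbar2 \<phi>)"
      using * Qbar2_admissible[OF assms] by auto
    \<comment> \<open>Squeeze: the transform does not lower the attained value, its result is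
      admissible for the other problem, and the two suprema agree.\<close>
    show "eint \<mu> (Q2 (Qbar2 \<phi>)) - eint \<nu> (Qbar2 \<phi>) = D2_right \<mu> \<nu>"
      using * eq Qbar2_dominates_dual_value[of \<mu> \<phi> \<nu>] D2_right_upper[OF Q, of \<mu>] by simp
  next
    assume *: "Acx \<phi> \<and> L1 \<nu> \<phi> \<and> eint \<mu> (Q2 \<phi>) - eint \<nu> \<phi> = D2_right \<mu> \<nu>"
    then show Q: "Acx (Q2 \<phi>)" "Sb2 (Q2 \<phi>)" using Acx_Q2 by auto
    show "eint \<mu> (Q2 \<phi>) - eint \<nu> (Qbar2 (Q2 \<phi>)) = D2_left \<mu> \<nu>"
      using * eq Q2_dominates_dual_value[of \<mu> \<phi> \<nu>] D2_left_upper[OF Q, of \<mu> \<nu>] by simp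
  }
qed

end
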